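(* Let $A$ be a finite alphabet, let $F:A^{\mathbb{Z}^2}\to A^{\mathbb{Z}^2}$ be a two-dimensional cellular automaton of radius $r$, and let $\mu$ be a bi-invariant probability measure on $A^{\mathbb{Z}^2}$ (invariant under $F$ and under all shifts). Then $$ER_\mu(A^{\mathbb{Z}^2},F)\le 8r\cdot h_\mu(A^{\mathbb{Z}^2},\sigma).$$
   Context: $A^{\mathbb{Z}^2}$ carries the product of discrete topologies and its Borel $\sigma$-algebra. The shifts are $\sigma^v(x)_u=x_{u+v}$, $u,v\in\mathbb{Z}^2$. Let $E_n=\{(i,j)\in\mathbb{Z}^2: -n\le i,j\le n\}$. A cellular automaton (CA) $F$ is a continuous self-map of $A^{\mathbb{Z}^2}$ commuting with all shifts; equivalently there are $r\in\mathbb{N}$ and $f:A^{E_r}\to A$ with $F(x)_z=f\big((x_{z+u})_{u\in E_r}\big)$ for all $z$; such an $r$ is called the radius of $F$. For $n\ge r$, $E'_n=E_n\setminus E_{n-r}$. For a finite measurable partition $\mathcal{P}$ of $A^{\mathbb{Z}^2}$, $\mathcal{P}_n=\bigvee_{v\in E_n}\sigma^v(\mathcal{P})$ and $\mathcal{P}'_n=\bigvee_{v\in E'_n}\sigma^v(\mathcal{P})$. $\mathcal{S}_0$ is the partition according to the value of the coordinate at $(0,0)$, and $\mathcal{S}_n=(\mathcal{S}_0)_n$ is the partition according to the pattern on $E_n$. $H_\mu$ denotes the Shannon entropy of a partition (natural logarithm) and $h_\mu(\mathcal{P},F)=\lim_{N}\frac1N H_\mu(\bigvee_{i=0}^{N-1}F^{-i}\mathcal{P})$.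 For an $F$-invariant probability measure $\mu$, $ER_\mu(\mathcal{P},F)=\limsup_{n\to\infty}\frac1n h_\mu(\mathcal{P}'_n,F)$, and $ER_\mu(A^{\mathbb{Z}^2},F)=\sup_{\mathcal{P}}ER_\mu(\mathcal{P},F)$ over all finite measurable partitions. The entropy of the two-dimensional shift is $h_\mu(A^{\mathbb{Z}^2},\sigma)=\lim_{n\to\infty}\frac{H_\mu(\mathcal{S}_n)}{(2n+1)^2}$. *)

theory Defs
  imports "HOL-Analysis.Analysis" "HOL-Probability.Probability"
begin

text \<open>The alphabet is a finite type \<open>'a\<close>. Abstract topologies are used so that \<open>'a\<close> need not
  carry a topology through a type class.\<close>

type_synonym 'a config = "int \<times> int \<Rightarrow> 'a"

definition config_topology :: "'a config topology" where
  "config_topology = product_topology (\<lambda>_. discrete_topology UNIV) UNIV"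

definition config_borel :: "'a config measure" where
  "config_borel = sigma UNIV {U. openin config_topology U}"

definition shift :: "int \<times> int \<Rightarrow> 'a config \<Rightarrow> 'a config" where
  "shift v x = (\<lambda>u. x (u + v))"

definition E :: "nat \<Rightarrow> (int \<times> int) set" where
  "E n = {- int n..int n} \<times> {- int n..int n}"

text \<open>Only meaningful for \<open>n \<ge> r\<close>; the truncated subtraction makes the remaining (finitely many)
  values irrelevant to the limit superior below.\<close>

definition E_ring :: "nat \<Rightarrow> nat \<Rightarrow> (int \<times> int) set" where
  "E_ring r n = E n - E (n - r)"

definition cellular_automaton :: "('a config \<Rightarrow> 'a config) \<Rightarrow> bool" where
  "cellular_automaton F \<longleftrightarrow>
     continuous_map config_topology config_topology F \<and> (\<forall>v. F \<circ> shift v = shift v \<circ> F)"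

text \<open>A local rule on patterns over \<open>E r\<close> is a function applied to extensional functions on \<open>E r\<close>.
  A radius need not be minimal.\<close>

definition has_radius :: "('a config \<Rightarrow> 'a config) \<Rightarrow> nat \<Rightarrow> bool" where
  "has_radius F r \<longleftrightarrow> (\<exists>f. \<forall>x z. F x z = f (restrict (\<lambda>u. x (z + u)) (E r)))"

definition invariant_under :: "'b measure \<Rightarrow> ('b \<Rightarrow> 'b) \<Rightarrow> bool" where
  "invariant_under \<mu> T \<longleftrightarrow> T \<in> measurable \<mu> \<mu> \<and> distr \<mu> \<mu> T = \<mu>"

definition bi_invariant :: "'a config measure \<Rightarrow> ('a config \<Rightarrow> 'a config) \<Rightarrow> bool" where
  "bi_invariant \<mu> F \<longleftrightarrow> invariant_under \<mu> F \<and> (\<forall>v. invariant_under \<mu> (shift v))"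

definition finite_measurable_partition :: "'a config set set \<Rightarrow> bool" where
  "finite_measurable_partition P \<longleftrightarrow>
     finite P \<and> P \<subseteq> sets config_borel \<and> partition_on UNIV P"

text \<open>The join of partitions is the library's \<^const>\<open>common_refinement\<close>, which discards empty cells;
  the join of the empty family is \<open>{UNIV}\<close>. Passing from an indexed family to the set of its members
  loses nothing, because the join of a partition with itself is that partition.\<close>

definition shift_join :: "(int \<times> int) set \<Rightarrow> 'a config set set \<Rightarrow> 'a config set set" where
  "shift_join V P = common_refinement ((\<lambda>v. (\<lambda>B. shift v ` B) ` P) ` V)"

definition pullback :: "('b \<Rightarrow> 'b) \<Rightarrow> nat \<Rightarrow> 'b set set \<Rightarrow> 'b set set" where
  "pullback F i P = (\<lambda>B. (F ^^ i) -` B) ` P - {{}}"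

definition S0 :: "'a config set set" where
  "S0 = range (\<lambda>a. {x. x (0, 0) = a})"

definition partition_entropy :: "'b measure \<Rightarrow> 'b set set \<Rightarrow> real" where
  "partition_entropy \<mu> P = - (\<Sum>B\<in>P. measure \<mu> B * ln (measure \<mu> B))"

text \<open>The limits in the next two definitions exist for invariant probability measures
  (by subadditivity), so \<^const>\<open>lim\<close> is not used outside its domain.\<close>

definition dyn_entropy :: "'b measure \<Rightarrow> 'b set set \<Rightarrow> ('b \<Rightarrow> 'b) \<Rightarrow> real" where
  "dyn_entropy \<mu> P F =
     lim (\<lambda>N. partition_entropy \<mu> (common_refinement ((\<lambda>i. pullback F i P) ` {..<N})) / real N)"

definition shift_entropy :: "'a config measure \<Rightarrow> real" where
  "shift_entropy \<mu> = lim (\<lambda>n. partition_entropy \<mu> (shift_join (E n) S0) / real ((2 * n + 1)\<^sup>2))"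

definition ER_partition ::
    "nat \<Rightarrow> 'a config measure \<Rightarrow> 'a config set set \<Rightarrow> ('a config \<Rightarrow> 'a config) \<Rightarrow> ereal" where
  "ER_partition r \<mu> P F =
     limsup (\<lambda>n. ereal (dyn_entropy \<mu> (shift_join (E_ring r n) P) F / real n))"

definition ER :: "nat \<Rightarrow> 'a config measure \<Rightarrow> ('a config \<Rightarrow> 'a config) \<Rightarrow> ereal" where
  "ER r \<mu> F = (SUP P\<in>{P. finite_measurable_partition P}. ER_partition r \<mu> P F)"

end

theory Submission
  imports Defs "HOL-Real_Asymp.Real_Asymp"
begin

text \<open>A finite partition is handled as the fibers of a random variable. Write \<open>G n\<close> for the entropy
  of the pattern on \<open>E n\<close>; subadditivity gives \<open>G n / (2n+1)\<^sup>2 \<longlonglongrightarrow> h\<close>, the entropy of the shift. Since \<open>m\<close> steps of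
  \<open>F\<close> on \<open>E n\<close> depend only on the pattern on \<open>E (n + r m)\<close>, cutting the orbit into blocks of length
  \<open>m\<close> bounds the \<open>F\<close>-entropy of the \<open>E n\<close>-pattern by \<open>(G (n + r m) - G n) / m\<close> for every \<open>m \<ge> 1\<close>.
  With \<open>m\<close> about \<open>\<epsilon> n\<close> and divided by \<open>n\<close> this tends to \<open>(8 r + 4 r\<^sup>2 \<epsilon>) h\<close>: choosing \<open>m\<close> proportional
  to \<open>n\<close> makes the mere convergence of \<open>G n / (2n+1)\<^sup>2\<close> sufficient. An arbitrary partition \<open>P\<close> is
  approximated by a partition \<open>Q\<close> into cylinders over some \<open>E k\<close> with \<open>H(P | Q) \<le> \<epsilon>\<close>; replacing \<open>P\<close> by \<open>Q\<close>
  costs at most \<open>\<epsilon>\<close> per site of the ring, whose cardinality is at most \<open>8 r n + 4 r\<close>.\<close>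

section \<open>Submodularity of entropy\<close>

context information_space
begin

text \<open>Entropy is the expectation of minus the logarithm of the probability of a point's own
  cell. Taking this expectation over the values of the finer variable \<open>T\<close> puts the
  entropies of several functions of \<open>T\<close> into sums over one index set.\<close>

lemma entropy_eq_expectation_factor:
  assumes T: "simple_function M T"
  shows "\<H>(g \<circ> T) = - (\<Sum>t\<in>T ` space M. prob (T -` {t} \<inter> space M)
           * log b (prob ((g \<circ> T) -` {g t} \<inter> space M)))"
proof -
  define S where "S = g \<circ> T"
  define L where "L s = log b (prob (S -` {s} \<inter> space M))" for s
  have S: "simple_function M S"
    unfolding S_def using T by auto
  have dT: "distributed M (count_space (T ` space M)) T (\<lambda>t. prob (T -` {t} \<inter> space M))"
    using simple_distributed[OF simple_distributedI[OF T measure_nonneg refl]] .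
  have dS: "distributed M (count_space (S ` space M)) S (\<lambda>t. prob (S -` {t} \<inter> space M))"
    using simple_distributed[OF simple_distributedI[OF S measure_nonneg refl]] .
  note fin = simple_functionD(1)[OF T] simple_functionD(1)[OF S]
  have "(\<Sum>t\<in>T ` space M. prob (T -` {t} \<inter> space M) * L (g t)) = (\<integral>x. L (g (T x)) \<partial>M)"
    using distributed_integral[OF dT, of "\<lambda>t. L (g t)"] fin
    by (simp add: lebesgue_integral_count_space_finite)
  also have "\<dots> = (\<integral>x. L (S x) \<partial>M)"
    by (simp add: S_def)
  also have "\<dots> = (\<Sum>s\<in>S ` space M. prob (S -` {s} \<inter> space M) * L s)"
    using distributed_integral[OF dS, of L] fin
    by (simp add: lebesgue_integral_count_space_finite)
  also have "\<dots> = - \<H>(S)"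
    by (subst entropy_simple_distributed[OF simple_distributedI[OF S measure_nonneg refl]])
       (simp add: L_def)
  finally show ?thesis
    by (simp add: S_def L_def)
qed

text \<open>This is nonnegativity of the conditional mutual information of \<open>X\<close> and
  \<open>Y\<close> given \<open>Z\<close>, whose sum over the values of \<open>(X, Y, Z)\<close>
  splits into the four entropies.\<close>

lemma entropy_submodular:
  assumes X: "simple_function M X" and Y: "simple_function M Y" and Z: "simple_function M Z"
  shows "\<H>(\<lambda>x. (X x, Y x, Z x)) + \<H>(Z) \<le> \<H>(\<lambda>x. (X x, Z x)) + \<H>(\<lambda>x. (Y x, Z x))"
proof -
  define T where "T = (\<lambda>x. (X x, Y x, Z x))"
  have T: "simple_function M T"
    unfolding T_def using X Y Z by auto
  define p where "p t = prob (T -` {t} \<inter> space M)" for t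
  define pz where "pz z = prob (Z -` {z} \<inter> space M)" for z
  define pxz where "pxz z = prob ((\<lambda>x. (X x, Z x)) -` {z} \<inter> space M)" for z
  define pyz where "pyz z = prob ((\<lambda>x. (Y x, Z x)) -` {z} \<inter> space M)" for z
  have mono: "p (x, y, z) \<le> pz z" "p (x, y, z) \<le> pxz (x, z)" "p (x, y, z) \<le> pyz (y, z)" for x y z
    unfolding p_def pz_def pxz_def pyz_def T_def
    using X Y Z simple_functionD(2)[of M] simple_functionD(2)[OF simple_function_Pair[OF X Z]]
      simple_functionD(2)[OF simple_function_Pair[OF Y Z]]
    by (auto intro!: finite_measure_mono simp del: simple_function_Pair)
  have "0 \<le> \<I>(X ; Y | Z)"
    by (rule conditional_mutual_information_nonneg[OF X Y Z])
  also have "\<I>(X ; Y | Z) = (\<Sum>(x, y, z)\<in>T ` space M.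
      p (x, y, z) * log b (p (x, y, z) / (pxz (x, z) * (pyz (y, z) / pz z))))"
    unfolding T_def p_def pxz_def pyz_def pz_def
    by (intro conditional_mutual_information_eq simple_distributedI simple_function_Pair
        X Y Z measure_nonneg refl)
  also have "\<dots> = (\<Sum>(x, y, z)\<in>T ` space M.
      p (x, y, z) * log b (p (x, y, z)) - p (x, y, z) * log b (pxz (x, z))
       - p (x, y, z) * log b (pyz (y, z)) + p (x, y, z) * log b (pz z))"
  proof (intro sum.cong refl, clarify)
    fix x y z
    show "p (x, y, z) * log b (p (x, y, z) / (pxz (x, z) * (pyz (y, z) / pz z))) =
      p (x, y, z) * log b (p (x, y, z)) - p (x, y, z) * log b (pxz (x, z))
       - p (x, y, z) * log b (pyz (y, z)) + p (x, y, z) * log b (pz z)"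
    \<comment> \<open>The logarithm splits only if all four probabilities are positive. The
      marginals dominate \<open>p (x, y, z)\<close>, and where that is zero every term
      vanishes.\<close>
    proof (cases "p (x, y, z) = 0")
      case False
      then have "p (x, y, z) > 0"
        by (simp add: p_def zero_less_measure_iff)
      with mono[of x y z] have "pz z > 0" "pxz (x, z) > 0" "pyz (y, z) > 0"
        by linarith+
      with \<open>p (x, y, z) > 0\<close> show ?thesis
        using b_gt_1 by (simp add: log_mult log_divide algebra_simps)
    qed simp
  qed
  also have "\<dots> = (\<Sum>t\<in>T ` space M. p t * log b (p t))
      - (\<Sum>t\<in>T ` space M. p t * log b (pxz (fst t, snd (snd t))))
      - (\<Sum>t\<in>T ` space M. p t * log b (pyz (snd t)))
      + (\<Sum>t\<in>T ` space M. p t * log b (pz (snd (snd t))))"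
    by (simp add: split_beta' sum.distrib sum_subtractf)
  \<comment> \<open>The four sums belong to the identity and to three projections of
    \<open>T\<close>.\<close>
  also have "\<dots> = - \<H>(T) + \<H>(\<lambda>x. (X x, Z x)) + \<H>(\<lambda>x. (Y x, Z x)) - \<H>(Z)"
    using entropy_eq_expectation_factor[OF T, of id]
      entropy_eq_expectation_factor[OF T, of "\<lambda>t. (fst t, snd (snd t))"]
      entropy_eq_expectation_factor[OF T, of snd]
      entropy_eq_expectation_factor[OF T, of "\<lambda>t. snd (snd t)"]
    by (simp add: p_def pxz_def pyz_def pz_def T_def comp_def)
  finally show ?thesis
    by (simp add: T_def)
qed

end

section \<open>Partitions as fibers\<close>

text \<open>Indexing by points instead of values leaves out empty cells, in agreement with
  \<open>common_refinement\<close> and \<open>pullback\<close>.\<close>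

definition fibers :: "('b \<Rightarrow> 'c) \<Rightarrow> 'b set set" where
  "fibers X = range (\<lambda>x. X -` {X x})"

definition joint :: "'i set \<Rightarrow> ('i \<Rightarrow> 'b \<Rightarrow> 'c) \<Rightarrow> 'b \<Rightarrow> 'i \<Rightarrow> 'c" where
  "joint I X x = restrict (\<lambda>i. X i x) I"

lemma joint_eq_iff: "joint I X x = joint I X y \<longleftrightarrow> (\<forall>i\<in>I. X i x = X i y)"
  by (auto simp: joint_def restrict_def fun_eq_iff)

text \<open>A partition records only which points share a value, so tuples may be regrouped and
  values recoded in another type.\<close>

lemma fibers_cong:
  assumes "\<And>x y. X x = X y \<longleftrightarrow> Y x = Y y"
  shows "fibers X = fibers Y"
proof -
  have "X -` {X x} = Y -` {Y x}" for x
    using assms by (auto simp: vimage_def)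
  then show ?thesis
    by (simp add: fibers_def)
qed

lemma Union_fiber: "\<Union>{B \<in> fibers X. x \<in> B} = X -` {X x}"
  by (auto simp: fibers_def)

lemma fiber_unique: "B \<in> fibers X \<Longrightarrow> x \<in> B \<Longrightarrow> B = X -` {X x}"
  by (auto simp: fibers_def)

text \<open>Turns a join, given through choice functions on a set of partitions, into one random
  variable. Indices with equal partitions impose the same condition, so identifying them is
  harmless.\<close>

lemma common_refinement_fibers:
  "common_refinement ((\<lambda>i. fibers (X i)) ` I) = fibers (joint I X)"
proof -
  let ?P = "(\<lambda>i. fibers (X i)) ` I"
  have cell: "joint I X -` {joint I X x} = (\<Inter>i\<in>I. X i -` {X i x})" for x
    by (auto simp: joint_eq_iff)
  show ?thesis
  proof (intro set_eqI iffI)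
    fix B assume "B \<in> common_refinement ?P"
    then obtain f x where f: "\<And>P. P \<in> ?P \<Longrightarrow> f P \<in> P" "B = \<Inter> (f ` ?P)" and x: "x \<in> B"
      unfolding common_refinement by auto
    \<comment> \<open>The chosen cell contains \<open>x\<close>, and only one fiber of
      \<open>X i\<close> does.\<close>
    have "f (fibers (X i)) = X i -` {X i x}" if "i \<in> I" for i
      using f x that by (intro fiber_unique) auto
    then have "B = joint I X -` {joint I X x}"
      unfolding cell f(2) by auto
    then show "B \<in> fibers (joint I X)"
      by (auto simp: fibers_def)
  next
    fix B assume "B \<in> fibers (joint I X)"
    then obtain x where B: "B = joint I X -` {joint I X x}"
      by (auto simp: fibers_def)
    \<comment> \<open>The choice must depend on the partition and not on an index. Exactly one cell
      contains \<open>x\<close>, so the union is that cell.\<close>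
    let ?f = "\<lambda>P. \<Union>{B \<in> P. x \<in> B}"
    have "?f P \<in> P" if "P \<in> ?P" for P
      using that by (auto simp: Union_fiber) (auto simp: fibers_def)
    then have "?f \<in> (\<Pi> P\<in>?P. P)"
      by (rule Pi_I)
    moreover have "B = \<Inter> (?f ` ?P)"
      unfolding B cell image_image Union_fiber ..
    then have "B \<in> {\<Inter> (?f ` ?P)}"
      by (simp only: singleton_iff)
    ultimately have "B \<in> (\<Union>f \<in> (\<Pi> P\<in>?P. P). {\<Inter> (f ` ?P)})"
      by - (rule UN_I[of ?f]; assumption)
    moreover have "x \<in> B"
      by (simp add: B)
    ultimately show "B \<in> common_refinement ?P"
      unfolding common_refinement by blast
  qed
qed

lemma pullback_fibers: "pullback T i (fibers X) = fibers (X \<circ> (T ^^ i))"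
proof (intro set_eqI iffI)
  fix B assume "B \<in> pullback T i (fibers X)"
  \<comment> \<open>The value \<open>X x\<close> need not be attained on the range of
    \<open>T ^^ i\<close>; since empty cells are removed, a point \<open>y\<close> of the cell
    attains it.\<close>
  then obtain x y where "B = (T ^^ i) -` X -` {X x}" "y \<in> B"
    by (auto simp: pullback_def fibers_def)
  then show "B \<in> fibers (X \<circ> (T ^^ i))"
    by (auto simp: fibers_def intro!: image_eqI[of _ _ y])
next
  fix B assume "B \<in> fibers (X \<circ> (T ^^ i))"
  then obtain y where B: "B = (T ^^ i) -` X -` {X ((T ^^ i) y)}"
    by (auto simp: fibers_def vimage_comp)
  moreover have "y \<in> B"
    by (simp add: B)
  ultimately show "B \<in> pullback T i (fibers X)"
    by (auto simp: pullback_def fibers_def)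
qed

text \<open>\<open>shift_join\<close> moves cells by images, while random variables compose through
  preimages; the inverse map exchanges the two.\<close>

lemma image_bij_fibers:
  assumes "\<And>x. S (S' x) = x" "\<And>x. S' (S x) = x"
  shows "(`) S ` fibers X = fibers (X \<circ> S')"
proof -
  have *: "S ` (X -` {X x}) = (X \<circ> S') -` {(X \<circ> S') (S x)}" for x
    using assms by (auto intro!: image_eqI[of _ S "S' _"])
  have "range S = UNIV"
    using assms(1) by (rule surjI)
  then have "fibers (X \<circ> S') = (\<lambda>y. (X \<circ> S') -` {(X \<circ> S') y}) ` range S"
    unfolding fibers_def by (rule arg_cong[OF sym])
  then show ?thesis
    unfolding fibers_def image_image * by (rule sym)
qed

section \<open>Entropy inequalities for finite-valued random variables\<close>

locale full_prob_space = prob_space +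
  assumes space_UNIV: "space M = UNIV"
begin

abbreviation H :: "('a \<Rightarrow> 'c) \<Rightarrow> real" where
  "H X \<equiv> partition_entropy M (fibers X)"

lemma H_eq_sum: "H X = - (\<Sum>s\<in>range X. prob (X -` {s}) * ln (prob (X -` {s})))"
proof -
  have "fibers X = (\<lambda>s. X -` {s}) ` range X"
    by (auto simp: fibers_def)
  moreover have "inj_on (\<lambda>s. X -` {s}) (range X)"
    by (force intro!: inj_onI)
  ultimately show ?thesis
    by (simp add: partition_entropy_def sum.reindex)
qed

lemma H_const: "H (\<lambda>_. c) = 0"
  using prob_space by (simp add: H_eq_sum space_UNIV)

text \<open>The base \<open>exp 1\<close> matches the natural logarithm in
  \<open>partition_entropy\<close>.\<close>

lemma H_eq_entropy:
  assumes X: "simple_function M X"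
  shows "H X = entropy (exp 1) (count_space (X ` space M)) X"
proof -
  interpret information_space M "exp 1"
    by unfold_locales simp
  show ?thesis
    by (subst entropy_simple_distributed[OF simple_distributedI[OF X measure_nonneg refl]])
       (simp add: H_eq_sum space_UNIV log_def)
qed

lemma simple_function_factor:
  assumes "simple_function M Y" "\<And>x y. Y x = Y y \<Longrightarrow> X x = X y"
  shows "simple_function M X"
proof -
  \<comment> \<open>\<open>inv Y\<close> picks a point with the same \<open>Y\<close>-value, hence
    the same \<open>X\<close>-value. As \<open>Y\<close> has finitely many values, the factor map
    needs no measurability.\<close>
  have "Y (inv Y (Y x)) = Y x" for x
    by (simp add: f_inv_into_f)
  then have "X = (X \<circ> inv Y) \<circ> Y"
    unfolding comp_def by (intro ext assms(2)[symmetric])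
  then show ?thesis
    using simple_function_compose[OF assms(1), of "X \<circ> inv Y"] by simp
qed

lemma H_mono:
  assumes Y: "simple_function M Y" and XY: "\<And>x y. Y x = Y y \<Longrightarrow> X x = X y"
  shows "H X \<le> H Y"
proof -
  interpret information_space M "exp 1"
    by unfold_locales simp
  have "Y (inv Y (Y x)) = Y x" for x
    by (simp add: f_inv_into_f)
  then have "X = (X \<circ> inv Y) \<circ> Y"
    unfolding comp_def by (intro ext XY[symmetric])
  then show ?thesis
    using entropy_data_processing[OF Y, of "X \<circ> inv Y"]
    by (simp add: H_eq_entropy Y simple_function_factor[OF Y XY])
qed

lemma H_nonneg: "simple_function M X \<Longrightarrow> 0 \<le> H X"
  using H_mono[of X "\<lambda>_. ()"] by (simp add: H_const)

lemma H_submodular: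
  assumes "simple_function M X" "simple_function M Y" "simple_function M Z"
  shows "H (\<lambda>x. (X x, Y x, Z x)) + H Z \<le> H (\<lambda>x. (X x, Z x)) + H (\<lambda>x. (Y x, Z x))"
proof -
  interpret information_space M "exp 1"
    by unfold_locales simp
  show ?thesis
    using entropy_submodular[OF assms] assms by (simp add: H_eq_entropy)
qed

lemma H_subadditive:
  assumes X: "simple_function M X" and Y: "simple_function M Y"
  shows "H (\<lambda>x. (X x, Y x)) \<le> H X + H Y"
proof -
  \<comment> \<open>Submodularity over a constant third variable, whose entropy is zero.\<close>
  have "H (\<lambda>x. (X x, Y x, ())) + H (\<lambda>x. ()) \<le> H (\<lambda>x. (X x, ())) + H (\<lambda>x. (Y x, ()))"
    by (intro H_submodular X Y) simp
  moreover have "fibers (\<lambda>x. (X x, Y x, ())) = fibers (\<lambda>x. (X x, Y x))"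
    "fibers (\<lambda>x. (X x, ())) = fibers X" "fibers (\<lambda>x. (Y x, ())) = fibers Y"
    by (auto intro!: fibers_cong)
  ultimately show ?thesis
    by (simp add: H_const)
qed

lemma simple_function_joint:
  assumes "finite I" "\<And>i. i \<in> I \<Longrightarrow> simple_function M (X i)"
  shows "simple_function M (joint I X)"
  using assms
proof (induction I)
  case empty
  show ?case
    by (rule simple_function_factor[of "\<lambda>_. ()"]) (auto simp: joint_eq_iff)
next
  case (insert j I)
  show ?case
    by (rule simple_function_factor[of "\<lambda>x. (X j x, joint I X x)"])
       (use insert in \<open>auto simp: joint_eq_iff\<close>)
qed

text \<open>Reading \<open>H (X, Y) - H Y\<close> as conditional entropy, a family given a family
  costs at most the sum of the costs of its members: further conditioning only lowers each
  term.\<close>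

lemma H_joint_le:
  assumes "finite I"
    and X: "\<And>i. i \<in> I \<Longrightarrow> simple_function M (X i)" and Y: "\<And>i. i \<in> I \<Longrightarrow> simple_function M (Y i)"
  shows "H (\<lambda>x. (joint I X x, joint I Y x))
    \<le> H (joint I Y) + (\<Sum>i\<in>I. H (\<lambda>x. (X i x, Y i x)) - H (Y i))"
  using assms
proof (induction I)
  case empty
  have "fibers (\<lambda>x. (joint {} X x, joint {} Y x)) = fibers (joint {} Y)"
    by (intro fibers_cong) (auto simp: joint_eq_iff)
  then show ?case
    by simp
next
  case (insert j I)
  let ?XI = "joint I X" and ?YI = "joint I Y"
  have sf: "simple_function M ?XI" "simple_function M ?YI" "simple_function M (X j)" "simple_function M (Y j)"
    using insert by (auto intro!: simple_function_joint)
  have "H (\<lambda>x. (joint (insert j I) X x, joint (insert j I) Y x))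
      \<le> H (\<lambda>x. ((?XI x, ?YI x), X j x, Y j x))"
    by (rule H_mono) (use sf in \<open>auto simp: joint_eq_iff\<close>)
  \<comment> \<open>Conditioning over \<open>Y j\<close>: adding \<open>X j\<close> costs at most
    its entropy given \<open>Y j\<close> alone.\<close>
  also have "\<dots> \<le> H (\<lambda>x. ((?XI x, ?YI x), Y j x)) + H (\<lambda>x. (X j x, Y j x)) - H (Y j)"
    using H_submodular[of "\<lambda>x. (?XI x, ?YI x)" "X j" "Y j"] sf by simp
  also have "H (\<lambda>x. ((?XI x, ?YI x), Y j x)) \<le> H (\<lambda>x. (?XI x, Y j x, ?YI x))"
    by (rule H_mono) (use sf in auto)
  \<comment> \<open>Conditioning over \<open>?YI\<close>: adding \<open>Y j\<close> to both families
    costs no more than adding it to \<open>?YI\<close>, which recovers the joint entropy of the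
    \<open>Y\<close>-family.\<close>
  also have "\<dots> \<le> H (\<lambda>x. (?XI x, ?YI x)) + H (\<lambda>x. (Y j x, ?YI x)) - H ?YI"
    using H_submodular[of ?XI "Y j" ?YI] sf by simp
  also have "H (\<lambda>x. (Y j x, ?YI x)) \<le> H (joint (insert j I) Y)"
    by (rule H_mono) (use insert in \<open>auto simp: joint_eq_iff intro!: simple_function_joint\<close>)
  also have "H (\<lambda>x. (?XI x, ?YI x)) \<le> H ?YI + (\<Sum>i\<in>I. H (\<lambda>x. (X i x, Y i x)) - H (Y i))"
    using insert by simp
  finally show ?case
    using insert by (simp add: algebra_simps)
qed

lemma H_joint_le_sum:
  assumes "finite I" and X: "\<And>i. i \<in> I \<Longrightarrow> simple_function M (X i)"
  shows "H (joint I X) \<le> (\<Sum>i\<in>I. H (X i))"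
proof -
  \<comment> \<open>Against constant variables the conditional entropies are plain
    entropies.\<close>
  have "H (\<lambda>x. (joint I X x, joint I (\<lambda>_ _. ()) x))
    \<le> H (joint I (\<lambda>_ _. ())) + (\<Sum>i\<in>I. H (\<lambda>x. (X i x, ())) - H (\<lambda>_. ()))"
    by (rule H_joint_le) (use assms in auto)
  moreover have "fibers (\<lambda>x. (joint I X x, joint I (\<lambda>_ _. ()) x)) = fibers (joint I X)"
    "fibers (joint I (\<lambda>_ _. ())) = fibers (\<lambda>_::'a. ())"
    "\<And>i. fibers (\<lambda>x. (X i x, ())) = fibers (X i)"
    by (auto intro!: fibers_cong simp: joint_eq_iff)
  ultimately show ?thesis
    by (simp add: H_const)
qed

section \<open>Composition with a measure-preserving map\<close>

lemma prob_vimage_invariant: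
  assumes "invariant_under M T" "A \<in> sets M"
  shows "prob (T -` A) = prob A"
  using assms measure_distr[of T M M A] unfolding invariant_under_def
  by (simp add: space_UNIV)

lemma simple_function_comp_invariant:
  assumes "invariant_under M T" "simple_function M X"
  shows "simple_function M (X \<circ> T)"
proof -
  have "range (X \<circ> T) \<subseteq> range X"
    by auto
  moreover have "(X \<circ> T) -` {y} \<in> sets M" for y
  proof -
    have "X -` {y} \<inter> space M \<in> sets M"
      using assms(2) by (rule simple_functionD)
    then have "T -` (X -` {y} \<inter> space M) \<inter> space M \<in> sets M"
      using assms(1) unfolding invariant_under_def by (blast intro: measurable_sets)
    then show ?thesis
      by (simp add: space_UNIV vimage_comp)
  qed
  ultimately show ?thesis
    using assms(2) finite_subset unfolding simple_function_def space_UNIV by auto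
qed

text \<open>If \<open>T\<close> is not surjective, \<open>X \<circ> T\<close> may miss values of
  \<open>X\<close>; by invariance these have probability zero and contribute nothing.\<close>

lemma H_invariant:
  assumes T: "invariant_under M T" and X: "simple_function M X"
  shows "H (X \<circ> T) = H X"
proof -
  have *: "prob ((X \<circ> T) -` {s}) = prob (X -` {s})" for s
    using prob_vimage_invariant[OF T, of "X -` {s}"] simple_functionD(2)[OF X, of "{s}"]
    by (simp add: space_UNIV vimage_comp)
  have "(\<Sum>s\<in>range (X \<circ> T). prob (X -` {s}) * ln (prob (X -` {s})))
      = (\<Sum>s\<in>range X. prob (X -` {s}) * ln (prob (X -` {s})))"
  proof (rule sum.mono_neutral_left)
    show "finite (range X)"
      using simple_functionD(1)[OF X] by (simp add: space_UNIV)
    show "\<forall>s\<in>range X - range (X \<circ> T). prob (X -` {s}) * ln (prob (X -` {s})) = 0"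
    proof
      fix s assume "s \<in> range X - range (X \<circ> T)"
      then have "(X \<circ> T) y \<noteq> s" for y
        by blast
      then have "(X \<circ> T) -` {s} = {}"
        by (auto simp del: comp_apply)
      then have "prob (X -` {s}) = 0"
        using *[of s] by simp
      then show "prob (X -` {s}) * ln (prob (X -` {s})) = 0"
        by simp
    qed
  qed auto
  then show ?thesis
    by (simp add: H_eq_sum *)
qed

lemma invariant_under_funpow:
  assumes "invariant_under M T"
  shows "invariant_under M (T ^^ i)"
proof (induction i)
  case 0
  then show ?case
    by (simp add: invariant_under_def distr_id id_def)
next
  case (Suc i)
  then show ?case
    using assms distr_distr[of T M M "T ^^ i" M] unfolding invariant_under_def
    by (auto intro: measurable_comp)
qed

end

section \<open>Dynamical entropy\<close>

text \<open>The last step of Fekete's argument: the limit is the infimum over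
  \<open>n \<ge> 1\<close>. It serves both for time averages and for averages over squares.\<close>

lemma convergent_eventually_le_member:
  fixes a :: "nat \<Rightarrow> real"
  assumes nonneg: "\<And>n. 0 \<le> a n"
    and le: "\<And>n e. n \<ge> 1 \<Longrightarrow> e > 0 \<Longrightarrow> eventually (\<lambda>N. a N \<le> a n + e) sequentially"
  shows "convergent a"
proof -
  define L where "L = Inf (a ` {1..})"
  have bdd: "bdd_below (a ` {1..})"
    using nonneg by (auto intro!: bdd_belowI[of _ 0])
  have "a \<longlonglongrightarrow> L"
  proof (rule order_tendstoI)
    fix y assume "y < L"
    then have "y < a N" if "N \<ge> 1" for N
      using cInf_lower[OF _ bdd, of "a N"] that unfolding L_def by fastforce
    then show "eventually (\<lambda>N. y < a N) sequentially"
      by (rule eventually_sequentiallyI)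
  next
    fix y assume "L < y"
    then obtain n where n: "n \<ge> 1" "a n < y"
      unfolding L_def using cInf_lessD[of "a ` {1..}" y] by auto
    then have "eventually (\<lambda>N. a N \<le> a n + (y - a n) / 2) sequentially"
      by (intro le) auto
    then show "eventually (\<lambda>N. a N < y) sequentially"
      by eventually_elim (use n in \<open>simp add: field_simps\<close>)
  qed
  then show ?thesis
    by (rule convergentI)
qed

lemma convergent_subadditive:
  fixes b :: "nat \<Rightarrow> real"
  assumes nonneg: "\<And>n. 0 \<le> b n" and sub: "\<And>m n. b (m + n) \<le> b m + b n" and zero: "b 0 \<le> 0"
  shows "convergent (\<lambda>N. b N / real N)"
proof (rule convergent_eventually_le_member)
  fix n :: nat and e :: real
  assume n: "n \<ge> 1" and e: "e > 0"
  have mult: "b (q * n) \<le> real q * b n" for q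
  proof (induction q)
    case (Suc q)
    then show ?case
      using sub[of n "q * n"] by (simp add: algebra_simps)
  qed (use zero in simp)
  \<comment> \<open>A bound, independent of \<open>N\<close>, for \<open>b\<close> at every
    remainder modulo \<open>n\<close>.\<close>
  define C where "C = (\<Sum>s<n. b s)"
  have "(\<lambda>N. C / real N) \<longlonglongrightarrow> 0"
    by real_asymp
  then have "eventually (\<lambda>N. C / real N < e) sequentially"
    using e by (rule order_tendstoD)
  with eventually_ge_at_top[of 1]
  show "eventually (\<lambda>N. b N / real N \<le> b n / real n + e) sequentially"
  proof eventually_elim
    case (elim N)
    have "b N = b (N div n * n + N mod n)"
      by simp
    also have "\<dots> \<le> real (N div n) * b n + b (N mod n)"
      using sub[of "N div n * n" "N mod n"] mult[of "N div n"] by linarith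
    also have "b (N mod n) \<le> C"
      unfolding C_def using n nonneg by (intro member_le_sum) auto
    also have "real (N div n) * b n \<le> real N / real n * b n"
      by (intro mult_right_mono nonneg of_nat_div_le_of_nat)
    finally have "b N / real N \<le> (real N / real n * b n + C) / real N"
      by (auto intro: divide_right_mono)
    also have "\<dots> = b n / real n + C / real N"
      using elim by (simp add: field_simps)
    finally show ?case
      using elim by simp
  qed
qed (use nonneg in auto)

context full_prob_space
begin

text \<open>Its fibers form the join whose entropy appears in \<open>dyn_entropy\<close>.\<close>

definition history :: "('a \<Rightarrow> 'a) \<Rightarrow> nat \<Rightarrow> ('a \<Rightarrow> 'c) \<Rightarrow> 'a \<Rightarrow> nat \<Rightarrow> 'c" where
  "history T N X = joint {..<N} (\<lambda>i. X \<circ> (T ^^ i))"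

lemma history_eq_iff:
  "history T N X x = history T N X y \<longleftrightarrow> (\<forall>i<N. X ((T ^^ i) x) = X ((T ^^ i) y))"
  by (auto simp: history_def joint_eq_iff)

lemma simple_function_comp_funpow:
  assumes "invariant_under M T" "simple_function M X"
  shows "simple_function M (X \<circ> (T ^^ i))"
  by (intro simple_function_comp_invariant invariant_under_funpow assms)

lemma H_funpow:
  assumes "invariant_under M T" "simple_function M X"
  shows "H (X \<circ> (T ^^ i)) = H X"
  by (intro H_invariant invariant_under_funpow assms)

lemma simple_function_history:
  assumes "invariant_under M T" "simple_function M X"
  shows "simple_function M (history T N X)"
  unfolding history_def by (intro simple_function_joint simple_function_comp_funpow assms) auto

text \<open>A history of length \<open>m + n\<close> consists of one of length \<open>m\<close> and
  one of length \<open>n\<close> observed \<open>m\<close> steps later; the latter has the same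
  entropy by invariance, so Fekete's lemma applies.\<close>

lemma dyn_entropy_tendsto:
  assumes T: "invariant_under M T" and X: "simple_function M X"
  shows "(\<lambda>N. H (history T N X) / real N) \<longlonglongrightarrow> dyn_entropy M (fibers X) T"
proof -
  have "convergent (\<lambda>N. H (history T N X) / real N)"
  proof (rule convergent_subadditive)
    show "0 \<le> H (history T n X)" for n
      by (intro H_nonneg simple_function_history assms)
    show "H (history T 0 X) \<le> 0"
      using H_mono[of "\<lambda>_. ()" "history T 0 X"] by (simp add: H_const joint_eq_iff history_eq_iff)
    fix m n
    let ?Y = "history T n X \<circ> (T ^^ m)"
    have sf: "simple_function M (history T m X)" "simple_function M ?Y"
      by (intro simple_function_history simple_function_comp_funpow assms)+
    have "H (history T (m + n) X) \<le> H (\<lambda>x. (history T m X x, ?Y x))"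
    proof (rule H_mono)
      fix x y assume eq: "(history T m X x, ?Y x) = (history T m X y, ?Y y)"
      have "X ((T ^^ i) x) = X ((T ^^ i) y)" if i: "i < m + n" for i
      proof (cases "i < m")
        case False
        then obtain j where "i = j + m" "j < n"
          using i by (intro that[of "i - m"]) auto
        then show ?thesis
          using eq by (auto simp: joint_eq_iff history_eq_iff funpow_add)
      qed (use eq in \<open>auto simp: joint_eq_iff history_eq_iff\<close>)
      then show "history T (m + n) X x = history T (m + n) X y"
        by (auto simp: joint_eq_iff history_eq_iff)
    qed (intro simple_function_Pair sf)
    also have "\<dots> \<le> H (history T m X) + H ?Y"
      by (intro H_subadditive sf)
    also have "H ?Y = H (history T n X)"
      by (intro H_funpow simple_function_history assms)
    finally show "H (history T (m + n) X) \<le> H (history T m X) + H (history T n X)" .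
  qed
  then show ?thesis
    unfolding dyn_entropy_def history_def pullback_fibers common_refinement_fibers
    by (simp add: convergent_LIMSEQ_iff history_def)
qed

lemma dyn_entropy_mono:
  assumes T: "invariant_under M T" and Y: "simple_function M Y"
    and XY: "\<And>x y. Y x = Y y \<Longrightarrow> X x = X y"
  shows "dyn_entropy M (fibers X) T \<le> dyn_entropy M (fibers Y) T"
proof (rule LIMSEQ_le)
  show "(\<lambda>N. H (history T N X) / real N) \<longlonglongrightarrow> dyn_entropy M (fibers X) T"
    by (intro dyn_entropy_tendsto T simple_function_factor[OF Y XY])
  show "(\<lambda>N. H (history T N Y) / real N) \<longlonglongrightarrow> dyn_entropy M (fibers Y) T"
    by (intro dyn_entropy_tendsto T Y)
  have "H (history T n X) \<le> H (history T n Y)" for n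
  proof (rule H_mono)
    fix x y assume "history T n Y x = history T n Y y"
    then show "history T n X x = history T n X y"
      unfolding history_eq_iff by (blast intro: XY)
  qed (intro simple_function_history T Y)
  then show "\<exists>N. \<forall>n\<ge>N. H (history T n X) / real n \<le> H (history T n Y) / real n"
    by (auto intro!: divide_right_mono)
qed

text \<open>\<open>H_joint_le\<close> is applied over times and sites together. By invariance the
  cost at a site is the same at each of the \<open>N\<close> times, and division by \<open>N\<close>
  leaves one copy of the sum.\<close>

lemma dyn_entropy_joint_le:
  assumes T: "invariant_under M T" and V: "finite V"
    and X: "\<And>v. v \<in> V \<Longrightarrow> simple_function M (X v)" and Y: "\<And>v. v \<in> V \<Longrightarrow> simple_function M (Y v)"
  shows "dyn_entropy M (fibers (joint V X)) T \<le> dyn_entropy M (fibers (joint V Y)) T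
    + (\<Sum>v\<in>V. H (\<lambda>x. (X v x, Y v x)) - H (Y v))" (is "_ \<le> _ + ?S")
proof (rule LIMSEQ_le)
  have sf: "simple_function M (joint V X)" "simple_function M (joint V Y)"
    by (intro simple_function_joint V X Y; assumption)+
  show "(\<lambda>N. H (history T N (joint V X)) / real N) \<longlonglongrightarrow> dyn_entropy M (fibers (joint V X)) T"
    by (intro dyn_entropy_tendsto T sf)
  show "(\<lambda>N. H (history T N (joint V Y)) / real N + ?S) \<longlonglongrightarrow> dyn_entropy M (fibers (joint V Y)) T + ?S"
    by (intro tendsto_intros dyn_entropy_tendsto T sf)
  have "H (history T N (joint V X)) / real N \<le> H (history T N (joint V Y)) / real N + ?S" if "N \<ge> 1" for N
  proof -
    let ?I = "{..<N} \<times> V"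
    let ?X = "\<lambda>(i, v). X v \<circ> (T ^^ i)" and ?Y = "\<lambda>(i, v). Y v \<circ> (T ^^ i)"
    have sfI: "simple_function M (?X i)" "simple_function M (?Y i)" if "i \<in> ?I" for i
      using that by (auto intro!: simple_function_comp_funpow T X Y)
    have sfJ: "simple_function M (joint ?I ?X)" "simple_function M (joint ?I ?Y)"
      by (rule simple_function_joint; use V sfI in blast)+
    have "H (history T N (joint V X)) \<le> H (\<lambda>x. (joint ?I ?X x, joint ?I ?Y x))"
      by (rule H_mono) (use sfJ in \<open>auto simp: joint_eq_iff history_eq_iff\<close>)
    also have "\<dots> \<le> H (joint ?I ?Y) + (\<Sum>i\<in>?I. H (\<lambda>x. (?X i x, ?Y i x)) - H (?Y i))"
      by (rule H_joint_le) (use V sfI in auto)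
    also have "(\<Sum>i\<in>?I. H (\<lambda>x. (?X i x, ?Y i x)) - H (?Y i)) = (\<Sum>i\<in>?I. H (\<lambda>x. (X (snd i) x, Y (snd i) x)) - H (Y (snd i)))"
    proof (rule sum.cong)
      fix i assume i: "i \<in> ?I"
      have "H ((\<lambda>x. (X (snd i) x, Y (snd i) x)) \<circ> (T ^^ fst i)) = H (\<lambda>x. (X (snd i) x, Y (snd i) x))"
        by (intro H_funpow T simple_function_Pair) (use X Y i in auto)
      moreover have "H (Y (snd i) \<circ> (T ^^ fst i)) = H (Y (snd i))"
        by (intro H_funpow T) (use Y i in auto)
      ultimately show "H (\<lambda>x. (?X i x, ?Y i x)) - H (?Y i) = H (\<lambda>x. (X (snd i) x, Y (snd i) x)) - H (Y (snd i))"
        by (simp add: split_beta comp_def)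
    qed simp
    also have "\<dots> = real N * ?S"
      by (simp add: sum.cartesian_product' split_beta)
    also have "H (joint ?I ?Y) \<le> H (history T N (joint V Y))"
      by (rule H_mono) (auto simp: joint_eq_iff history_eq_iff intro!: simple_function_history T sf)
    finally have "H (history T N (joint V X)) / real N \<le> (H (history T N (joint V Y)) + real N * ?S) / real N"
      by (intro divide_right_mono) auto
    then show ?thesis
      using that by (simp add: add_divide_distrib)
  qed
  then show "\<exists>N. \<forall>n\<ge>N. H (history T n (joint V X)) / real n \<le> H (history T n (joint V Y)) / real n + ?S"
    by blast
qed

text \<open>In each block of \<open>m\<close> steps the new part of the \<open>Y\<close>-history is a function of \<open>Z\<close> at the start of
  the block, and \<open>Y\<close> at that time is already known; so a block costs at most \<open>H(Z | Y)\<close>.\<close>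

lemma dyn_entropy_le_increment:
  assumes T: "invariant_under M T" and Y: "simple_function M Y" and Z: "simple_function M Z"
    and m: "m \<ge> 1"
    and ZY: "\<And>i x y. i \<le> m \<Longrightarrow> Z x = Z y \<Longrightarrow> Y ((T ^^ i) x) = Y ((T ^^ i) y)"
  shows "dyn_entropy M (fibers Y) T \<le> (H Z - H Y) / real m"
proof (rule LIMSEQ_le)
  \<comment> \<open>The extra \<open>1\<close> includes time \<open>N * m\<close>, so the
    \<open>Y\<close>-value at the start of the next block is already known.\<close>
  let ?W = "\<lambda>N. history T (N * m + 1) Y"
  have sfW: "simple_function M (?W N)" for N
    by (intro simple_function_history T Y)
  have bound: "H (?W N) \<le> H Y + real N * (H Z - H Y)" for N
  proof (induction N)
    case 0
    have "H (?W 0) \<le> H Y"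
      by (rule H_mono) (auto simp: joint_eq_iff history_eq_iff Y)
    then show ?case
      by simp
  next
    case (Suc N)
    let ?V = "Z \<circ> (T ^^ (N * m))" and ?U = "Y \<circ> (T ^^ (N * m))"
    have sf: "simple_function M ?V" "simple_function M ?U"
      by (intro simple_function_comp_funpow T Y Z)+
    have "H (?W (Suc N)) \<le> H (\<lambda>x. (?W N x, ?V x, ?U x))"
    proof (rule H_mono)
      fix x y assume eq: "(?W N x, ?V x, ?U x) = (?W N y, ?V y, ?U y)"
      have "Y ((T ^^ i) x) = Y ((T ^^ i) y)" if "i < Suc N * m + 1" for i
      proof (cases "i < N * m")
        case False
        then have i: "i = (i - N * m) + N * m" "i - N * m \<le> m"
          using that by auto
        show ?thesis
          using eq ZY[OF i(2), of "(T ^^ (N * m)) x" "(T ^^ (N * m)) y"]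
          by (subst (1 2) i(1)) (simp add: funpow_add del: le_add_diff_inverse2)
      qed (use eq in \<open>auto simp: joint_eq_iff history_eq_iff\<close>)
      then show "?W (Suc N) x = ?W (Suc N) y"
        by (auto simp: joint_eq_iff history_eq_iff)
    qed (intro simple_function_Pair sf sfW)
    also have "\<dots> \<le> H (\<lambda>x. (?W N x, ?U x)) + H (\<lambda>x. (?V x, ?U x)) - H ?U"
      using H_submodular[OF sfW sf, of N] by linarith
    also have "H (\<lambda>x. (?W N x, ?U x)) \<le> H (?W N)"
      by (rule H_mono) (use sfW in \<open>auto simp: joint_eq_iff history_eq_iff\<close>)
    \<comment> \<open>By the case \<open>i = 0\<close> of \<open>ZY\<close>, \<open>Z\<close>
      determines \<open>Y\<close>.\<close>
    also have "H (\<lambda>x. (?V x, ?U x)) \<le> H ?V"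
    proof (rule H_mono)
      fix x y assume "?V x = ?V y"
      then show "(?V x, ?U x) = (?V y, ?U y)"
        using ZY[of 0 "(T ^^ (N * m)) x" "(T ^^ (N * m)) y"] by simp
    qed (rule sf)
    also have "H ?V = H Z"
      by (intro H_funpow T Z)
    also have "H ?U = H Y"
      by (intro H_funpow T Y)
    finally show ?case
      using Suc by (simp add: algebra_simps)
  qed
  \<comment> \<open>The limit exists, so it can be computed along the lengths
    \<open>N * m + 1\<close>.\<close>
  have "strict_mono (\<lambda>N. N * m + 1)"
    using m by (auto intro!: strict_monoI)
  from LIMSEQ_subseq_LIMSEQ[OF dyn_entropy_tendsto[OF T Y] this]
  show "(\<lambda>N. H (?W N) / real (N * m + 1)) \<longlonglongrightarrow> dyn_entropy M (fibers Y) T"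
    by (simp add: comp_def)
  have "real m > 0"
    using m by simp
  then have "(\<lambda>N. (c + real N * d) / (real N * real m + 1)) \<longlonglongrightarrow> d * inverse (real m)" for c d :: real
    by real_asymp
  then show "(\<lambda>N. (H Y + real N * (H Z - H Y)) / real (N * m + 1)) \<longlonglongrightarrow> (H Z - H Y) / real m"
    by (simp add: divide_inverse add.commute)
  show "\<exists>N. \<forall>n\<ge>N. H (?W n) / real (n * m + 1) \<le> (H Y + real n * (H Z - H Y)) / real (n * m + 1)"
    using bound by (auto intro!: divide_right_mono)
qed

end

section \<open>Configurations\<close>

definition pattern :: "(int \<times> int) set \<Rightarrow> 'a config \<Rightarrow> int \<times> int \<Rightarrow> 'a" where
  "pattern V = joint V (\<lambda>v x. x v)"

lemma pattern_eq_iff: "pattern V x = pattern V y \<longleftrightarrow> (\<forall>v\<in>V. x v = y v)"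
  by (simp add: pattern_def joint_eq_iff)

lemma finite_E [simp]: "finite (E n)"
  by (simp add: E_def)

lemma E_mono: "m \<le> n \<Longrightarrow> E m \<subseteq> E n"
  by (auto simp: E_def)

lemma E_add: "u \<in> E m \<Longrightarrow> v \<in> E n \<Longrightarrow> u + v \<in> E (m + n)"
  by (auto simp: E_def)

lemma uminus_in_E_iff [simp]: "- v \<in> E n \<longleftrightarrow> v \<in> E n"
  by (cases v) (auto simp: E_def)

lemma card_E: "card (E n) = (2 * n + 1)\<^sup>2"
proof -
  have "card {- int n..int n} = 2 * n + 1"
    unfolding card_atLeastAtMost_int by linarith
  then show ?thesis
    by (simp add: E_def card_cartesian_product power2_eq_square)
qed

text \<open>A difference of two squares. It only weights the approximation error per site; the
  factor \<open>8 r\<close> of the entropy term comes from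
  \<open>tendsto_square_increment\<close>.\<close>

lemma card_E_ring_le:
  assumes "r \<le> n"
  shows "real (card (E_ring r n)) \<le> 8 * real r * real n + 4 * real r"
proof -
  have "card (E_ring r n) = card (E n) - card (E (n - r))"
    unfolding E_ring_def by (intro card_Diff_subset E_mono) auto
  moreover have "card (E (n - r)) \<le> card (E n)"
    by (intro card_mono E_mono) auto
  ultimately have "real (card (E_ring r n)) = (2 * real n + 1)\<^sup>2 - (2 * (real n - real r) + 1)\<^sup>2"
    using assms by (simp add: card_E of_nat_diff add_ac)
  also have "\<dots> = 8 * real r * real n + 4 * real r - 4 * (real r)\<^sup>2"
    by (simp add: power2_eq_square algebra_simps)
  finally show ?thesis
    by simp
qed

lemma shift_shift_uminus: "shift v (shift (- v) x) = x" "shift (- v) (shift v x) = x"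
  by (simp_all add: shift_def add.assoc)

lemma shift_join_fibers: "shift_join V (fibers X) = fibers (joint V (\<lambda>v. X \<circ> shift (- v)))"
proof -
  have "(`) (shift v) ` fibers X = fibers (X \<circ> shift (- v))" for v
    by (rule image_bij_fibers) (rule shift_shift_uminus)+
  then show ?thesis
    by (simp add: shift_join_def common_refinement_fibers)
qed

text \<open>Each application of \<open>F\<close> shrinks the window on which two configurations are
  known to agree by \<open>r\<close> on every side.\<close>

lemma pattern_funpow_eq:
  assumes F: "has_radius F r" and eq: "pattern (E (n + r * m)) x = pattern (E (n + r * m)) y"
    and "i \<le> m"
  shows "pattern (E n) ((F ^^ i) x) = pattern (E n) ((F ^^ i) y)"
proof -
  obtain f where f: "\<And>x z. F x z = f (restrict (\<lambda>u. x (z + u)) (E r))"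
    using F unfolding has_radius_def by blast
  have step: "pattern (E n) (F x) = pattern (E n) (F y)"
    if "pattern (E (n + r)) x = pattern (E (n + r)) y" for n x y
    unfolding pattern_eq_iff
  proof
    fix z assume "z \<in> E n"
    then have "restrict (\<lambda>u. x (z + u)) (E r) = restrict (\<lambda>u. y (z + u)) (E r)"
      using that by (auto simp: pattern_eq_iff intro!: restrict_ext dest: E_add)
    then show "F x z = F y z"
      by (simp add: f)
  qed
  \<comment> \<open>Shrinking the window to exactly \<open>n + r * i\<close> lets the induction on
    \<open>i\<close> peel off the first application of \<open>F\<close>.\<close>
  have "pattern (E (n + r * i)) x = pattern (E (n + r * i)) y"
    using eq E_mono[of "n + r * i" "n + r * m"] \<open>i \<le> m\<close> by (auto simp: pattern_eq_iff)
  then show ?thesis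
  proof (induction i arbitrary: x y)
    case (Suc i)
    have "pattern (E (n + r * i)) (F x) = pattern (E (n + r * i)) (F y)"
      by (rule step) (use Suc.prems in \<open>simp add: algebra_simps\<close>)
    from Suc.IH[OF this] show ?case
      by (simp add: funpow_Suc_right del: funpow.simps)
  qed simp
qed

lemma S0_eq_fibers: "S0 = fibers (\<lambda>x. x (0, 0))"
proof (intro set_eqI iffI)
  fix B :: "'a config set" assume "B \<in> S0"
  then obtain a where "B = {x. x (0, 0) = a}"
    by (auto simp: S0_def)
  \<comment> \<open>The constant configuration shows that the letter \<open>a\<close>
    occurs.\<close>
  then show "B \<in> fibers (\<lambda>x. x (0, 0))"
    by (auto simp: fibers_def vimage_def intro!: image_eqI[of _ _ "\<lambda>_. a"])
qed (auto simp: S0_def fibers_def vimage_def)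

text \<open>The cells are disjoint and cover the space, so two points have the same membership
  vector exactly when they share a cell.\<close>

lemma partition_eq_fibers:
  assumes "partition_on UNIV P"
  shows "P = fibers (joint P (\<lambda>B x. x \<in> B))" (is "P = fibers ?X")
proof -
  have cell: "?X -` {?X x} = B" if "x \<in> B" "B \<in> P" for x B
  proof -
    have unique: "C = B" if "y \<in> B" "y \<in> C" "C \<in> P" for y C
      using that \<open>B \<in> P\<close> assms by (auto simp: partition_on_def disjoint_def)
    have "?X y = ?X x \<longleftrightarrow> y \<in> B" for y
      unfolding joint_eq_iff using that unique by blast
    then show ?thesis
      by auto
  qed
  show ?thesis
  proof (intro set_eqI iffI)
    fix B assume "B \<in> P"
    moreover from this obtain x where "x \<in> B"
      using assms partition_onD3 by fastforce
    ultimately show "B \<in> fibers ?X"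
      using cell[of x B] unfolding fibers_def by (metis rangeI)
  next
    fix B assume "B \<in> fibers ?X"
    then obtain x where B: "B = ?X -` {?X x}"
      by (auto simp: fibers_def)
    obtain C where "C \<in> P" "x \<in> C"
      using partition_onD1[OF assms] by auto
    then show "B \<in> P"
      using B cell by simp
  qed
qed

lemma open_coordinate: "openin config_topology {x. x v = a}"
proof -
  have "continuous_map config_topology (discrete_topology UNIV) (\<lambda>x. x v)"
    unfolding config_topology_def by (intro continuous_map_product_projection) simp
  then have "openin config_topology {x \<in> topspace config_topology. x v \<in> {a}}"
    by (rule openin_continuous_map_preimage) simp
  then show ?thesis
    by (simp add: config_topology_def)
qed

lemma sets_config_borel: "sets config_borel = sigma_sets UNIV {U. openin config_topology U}"
  by (simp add: config_borel_def)

text \<open>A basic open set of the product restricts only finitely many coordinates, and these lie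
  in one square.\<close>

lemma openin_config_cylinder:
  assumes "openin config_topology U" "x \<in> U"
  obtains k where "\<And>y. pattern (E k) y = pattern (E k) x \<Longrightarrow> y \<in> U"
proof -
  have "\<exists>W. finite {i \<in> UNIV. W i \<noteq> topspace (discrete_topology UNIV)} \<and>
      (\<forall>i\<in>UNIV. openin (discrete_topology UNIV) (W i)) \<and> x \<in> Pi\<^sub>E UNIV W \<and> Pi\<^sub>E UNIV W \<subseteq> U"
    using assms unfolding config_topology_def openin_product_topology_alt by (rule bspec)
  then obtain W where W: "finite {i. W i \<noteq> UNIV}" "x \<in> Pi\<^sub>E UNIV W" "Pi\<^sub>E UNIV W \<subseteq> U"
    by auto
  have "\<exists>k. S \<subseteq> E k" if "finite S" for S :: "(int \<times> int) set"
    using that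
  proof induction
    case (insert u S)
    then obtain k where k: "S \<subseteq> E k"
      by blast
    obtain a b where "u = (a, b)"
      by fastforce
    then have "u \<in> E (nat \<bar>a\<bar> + nat \<bar>b\<bar>)"
      by (auto simp: E_def)
    then have "insert u S \<subseteq> E (k + (nat \<bar>a\<bar> + nat \<bar>b\<bar>))"
      using k E_mono[of k "k + (nat \<bar>a\<bar> + nat \<bar>b\<bar>)"]
        E_mono[of "nat \<bar>a\<bar> + nat \<bar>b\<bar>" "k + (nat \<bar>a\<bar> + nat \<bar>b\<bar>)"] by auto
    then show ?case
      by blast
  qed simp
  from this[OF W(1)] obtain k where k: "{i. W i \<noteq> UNIV} \<subseteq> E k"
    by blast
  have "y \<in> U" if "pattern (E k) y = pattern (E k) x" for y
  proof -
    have "y i \<in> W i" for i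
    proof (cases "i \<in> E k")
      case True
      then show ?thesis
        using that W(2) by (auto simp: pattern_eq_iff)
    qed (use k in auto)
    then show ?thesis
      using W(3) by auto
  qed
  then show thesis
    by (rule that)
qed

section \<open>Approximation by cylinders\<close>

locale shift_invariant_measure = prob_space M
  for M :: "('a::finite) config measure" +
  assumes sets_M: "sets M = sets config_borel"
    and shift_invariant: "\<And>v. invariant_under M (shift v)"

sublocale shift_invariant_measure \<subseteq> full_prob_space M
proof
  show "space M = UNIV"
    using sets_eq_imp_space_eq[OF sets_M] by (simp add: config_borel_def)
qed

context shift_invariant_measure
begin

lemma simple_function_pattern: "finite V \<Longrightarrow> simple_function M (pattern V)"
  unfolding pattern_def
proof (rule simple_function_joint)
  fix v
  have "{x. x v = a} \<in> sets M" for a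
    unfolding sets_M sets_config_borel using open_coordinate by (intro sigma_sets.Basic CollectI)
  then show "simple_function M (\<lambda>x. x v)"
    by (simp add: simple_function_def space_UNIV vimage_def)
qed

lemma simple_function_indicator_member: "A \<in> sets M \<Longrightarrow> simple_function M (\<lambda>x. x \<in> A)"
proof -
  assume "A \<in> sets M"
  moreover from this have "- A \<in> sets M"
    using sets.compl_sets[of A M] by (simp add: space_UNIV Compl_eq_Diff_UNIV)
  moreover have "(\<lambda>x. x \<in> A) -` {b} = (if b then A else - A)" for b
    by auto
  ultimately show ?thesis
    by (simp add: simple_function_def space_UNIV)
qed

text \<open>Finite unions of cylinders over \<open>E k\<close>. One implication suffices because
  equality of patterns is symmetric.\<close>

definition determined :: "nat \<Rightarrow> 'a config set \<Rightarrow> bool" where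
  "determined k C \<longleftrightarrow> (\<forall>x y. pattern (E k) x = pattern (E k) y \<longrightarrow> x \<in> C \<longrightarrow> y \<in> C)"

lemma determined_mono: "determined k C \<Longrightarrow> k \<le> l \<Longrightarrow> determined l C"
  unfolding determined_def pattern_eq_iff using E_mono by blast

lemma determined_sets: "determined k C \<Longrightarrow> C \<in> sets M"
proof -
  assume C: "determined k C"
  have "simple_function M (\<lambda>x. x \<in> C)"
  proof (rule simple_function_factor)
    show "simple_function M (pattern (E k))"
      by (intro simple_function_pattern finite_E)
    show "(x \<in> C) = (y \<in> C)" if "pattern (E k) x = pattern (E k) y" for x y
      using C that that[symmetric] unfolding determined_def by blast
  qed
  from simple_functionD(2)[OF this, of "{True}"] show ?thesis
    by (simp add: space_UNIV vimage_def)
qed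

definition approximable :: "'a config set \<Rightarrow> bool" where
  "approximable A \<longleftrightarrow> (\<forall>e>0. \<exists>k C. determined k C \<and> prob ((A - C) \<union> (C - A)) < e)"

text \<open>By continuity from below some \<open>A n\<close> is within \<open>e / 2\<close> of the
  union, and a determined set within \<open>e / 2\<close> of \<open>A n\<close> serves for the
  union.\<close>

lemma approximable_incseq:
  assumes meas: "\<And>n. A n \<in> sets M" and inc: "incseq A" and approx: "\<And>n. approximable (A n)"
  shows "approximable (\<Union>n. A n)"
  unfolding approximable_def
proof (intro allI impI)
  fix e :: real assume "e > 0"
  let ?A = "\<Union>n. A n"
  have "(\<lambda>n. prob (A n)) \<longlonglongrightarrow> prob ?A"
    by (intro finite_Lim_measure_incseq inc) (use meas in auto)
  then have "eventually (\<lambda>n. prob ?A - e / 2 < prob (A n)) sequentially"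
    by (rule order_tendstoD) (use \<open>e > 0\<close> in simp)
  then obtain n where n: "prob ?A - e / 2 < prob (A n)"
    by (auto simp: eventually_sequentially)
  obtain k C where C: "determined k C" "prob ((A n - C) \<union> (C - A n)) < e / 2"
    using approx[of n] \<open>e > 0\<close> unfolding approximable_def by (meson half_gt_zero)
  note [measurable] = meas determined_sets[OF C(1)]
  have "prob ((?A - C) \<union> (C - ?A)) \<le> prob ((?A - A n) \<union> ((A n - C) \<union> (C - A n)))"
    by (rule finite_measure_mono) auto
  also have "\<dots> \<le> prob (?A - A n) + prob ((A n - C) \<union> (C - A n))"
    by (rule measure_Un_le) auto
  also have "prob (?A - A n) = prob ?A - prob (A n)"
    by (rule finite_measure_Diff) auto
  finally have "prob ((?A - C) \<union> (C - ?A)) < e"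
    using n C(2) by simp
  with C(1) show "\<exists>k C. determined k C \<and> prob ((?A - C) \<union> (C - ?A)) < e"
    by blast
qed

lemma approximable_determined: "determined k C \<Longrightarrow> approximable C"
  unfolding approximable_def by (intro allI impI exI[of _ k] exI[of _ C]) simp

text \<open>The symmetric difference of unions lies in the union of the symmetric differences; both
  approximants are read over the larger window.\<close>

lemma approximable_Un:
  assumes meas: "A \<in> sets M" "B \<in> sets M" and approx: "approximable A" "approximable B"
  shows "approximable (A \<union> B)"
  unfolding approximable_def
proof (intro allI impI)
  fix e :: real assume "e > 0"
  obtain k C where C: "determined k C" "prob ((A - C) \<union> (C - A)) < e / 2"
    using approx(1) \<open>e > 0\<close> unfolding approximable_def by (meson half_gt_zero)
  obtain l D where D: "determined l D" "prob ((B - D) \<union> (D - B)) < e / 2"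
    using approx(2) \<open>e > 0\<close> unfolding approximable_def by (meson half_gt_zero)
  note [measurable] = meas determined_sets[OF C(1)] determined_sets[OF D(1)]
  have "determined (max k l) C" "determined (max k l) D"
    using C(1) D(1) by (auto intro: determined_mono)
  then have "determined (max k l) (C \<union> D)"
    unfolding determined_def by blast
  moreover have "prob ((A \<union> B - (C \<union> D)) \<union> (C \<union> D - (A \<union> B)))
      \<le> prob (((A - C) \<union> (C - A)) \<union> ((B - D) \<union> (D - B)))"
    by (rule finite_measure_mono) auto
  moreover have "\<dots> \<le> prob ((A - C) \<union> (C - A)) + prob ((B - D) \<union> (D - B))"
    by (rule measure_Un_le) auto
  ultimately show "\<exists>k C. determined k C \<and> prob ((A \<union> B - C) \<union> (C - (A \<union> B))) < e"
    using C(2) D(2) by (intro exI[of _ "max k l"] exI[of _ "C \<union> D"]) linarith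
qed

text \<open>An open set is the increasing union of the sets of those points whose whole cylinder over
  \<open>E k\<close> it contains.\<close>

lemma approximable_open:
  assumes "openin config_topology U"
  shows "approximable U"
proof -
  define C where "C k = {x. \<forall>y. pattern (E k) y = pattern (E k) x \<longrightarrow> y \<in> U}" for k
  have det: "determined k (C k)" for k
    by (simp add: determined_def C_def)
  have "incseq C"
    unfolding incseq_def C_def pattern_eq_iff using E_mono by blast
  then have "approximable (\<Union>k. C k)"
    using det by (intro approximable_incseq) (auto intro: determined_sets approximable_determined)
  moreover have "(\<Union>k. C k) = U"
  proof (intro set_eqI iffI)
    fix x assume "x \<in> U"
    then obtain k where "\<And>y. pattern (E k) y = pattern (E k) x \<Longrightarrow> y \<in> U"
      using openin_config_cylinder[OF assms] by metis
    then show "x \<in> (\<Union>k. C k)"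
      by (auto simp: C_def)
  qed (auto simp: C_def)
  ultimately show ?thesis
    by simp
qed

text \<open>Induction over the generated sigma-algebra: complements keep the symmetric difference,
  and a countable union is the increasing union of its finite partial unions.\<close>

lemma approximable_sets:
  assumes "A \<in> sets M"
  shows "approximable A"
proof -
  have "A \<in> sigma_sets UNIV {U. openin config_topology U}"
    using assms by (simp add: sets_M sets_config_borel)
  then show ?thesis
  proof induction
    case (Basic U)
    then show ?case
      by (auto intro: approximable_open)
  next
    case Empty
    show ?case
      by (rule approximable_determined[of 0]) (simp add: determined_def)
  next
    case (Compl A)
    have "determined k (- C)" if "determined k C" for k C
      using that unfolding determined_def by (metis Compl_iff)
    moreover have "((UNIV - A) - (- C)) \<union> (- C - (UNIV - A)) = (A - C) \<union> (C - A)" for C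
      by auto
    ultimately show ?case
      using Compl unfolding approximable_def by metis
  next
    case (Union A)
    have meas: "A i \<in> sets M" for i
      using Union(1) by (simp add: sets_M sets_config_borel)
    let ?B = "\<lambda>n. \<Union>i<n. A i"
    have "approximable (?B n)" for n
    proof (induction n)
      case 0
      show ?case
        by (rule approximable_determined[of 0]) (simp add: determined_def)
    next
      case (Suc n)
      have "approximable (?B n \<union> A n)"
        using Suc Union(2) meas by (intro approximable_Un) auto
      then show ?case
        by (simp add: lessThan_Suc Un_commute)
    qed
    then have "approximable (\<Union>n. ?B n)"
      using meas by (intro approximable_incseq) (auto simp: incseq_def, force)
    moreover have "(\<Union>n. ?B n) = (\<Union>i. A i)"
      by auto
    ultimately show ?case
      by simp
  qed
qed

end

section \<open>Entropy of patterns\<close>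

text \<open>As \<open>c n / n\<close> tends to \<open>\<delta>\<close>, each \<open>G\<close>-term
  behaves like \<open>h\<close> times \<open>(2 n + 2 j c n)\<^sup>2 / (n c n)\<close>, with limit
  \<open>h (2 + 2 j \<delta>)\<^sup>2 / \<delta>\<close>. Subtracting the case \<open>j = 0\<close>
  from \<open>j = r\<close> gives the constant. No rate of convergence is needed, since
  \<open>c n * n\<close> has the order of the area.\<close>

lemma tendsto_square_increment:
  fixes G :: "nat \<Rightarrow> real" and \<delta> h :: real and r k :: nat
  assumes G: "(\<lambda>n. G n / real ((2 * n + 1)\<^sup>2)) \<longlonglongrightarrow> h" and \<delta>: "\<delta> > 0"
  defines "c \<equiv> \<lambda>n. nat \<lceil>\<delta> * real n\<rceil>"
  shows "(\<lambda>n. (G (n + k + r * c n) - G (n + k)) / real (c n) / real n)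
    \<longlonglongrightarrow> (8 * real r + 4 * (real r)\<^sup>2 * \<delta>) * h"
proof -
  have ratio: "(\<lambda>n. real (c n) / real n) \<longlonglongrightarrow> \<delta>"
  proof (rule tendsto_sandwich)
    have c: "\<delta> * real n \<le> real (c n)" "real (c n) \<le> \<delta> * real n + 1" for n
      using \<delta> unfolding c_def by (simp_all add: of_nat_nat)
    show "eventually (\<lambda>n. \<delta> \<le> real (c n) / real n) sequentially"
      using eventually_gt_at_top[of 0] by eventually_elim (use c in \<open>simp add: field_simps\<close>)
    show "eventually (\<lambda>n. real (c n) / real n \<le> \<delta> + 1 / real n) sequentially"
      using eventually_gt_at_top[of 0] by eventually_elim (use c in \<open>simp add: field_simps\<close>)
    show "(\<lambda>n. \<delta> + 1 / real n) \<longlonglongrightarrow> \<delta>"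
      by real_asymp
  qed simp
  have G': "(\<lambda>n. G (s n) / real ((2 * s n + 1)\<^sup>2)) \<longlonglongrightarrow> h" if "\<And>n. n \<le> s n" for s
    using that by (intro filterlim_compose[OF G] filterlim_at_top_mono[OF filterlim_ident]) auto
  have small: "(\<lambda>n. (2 * real k + 1) / real n) \<longlonglongrightarrow> 0"
    by real_asymp
  have scale: "(\<lambda>n. (2 * real j * (real (c n) / real n) + 2 + (2 * real k + 1) / real n)\<^sup>2 / (real (c n) / real n))
      \<longlonglongrightarrow> (2 * real j * \<delta> + 2 + 0)\<^sup>2 / \<delta>" for j :: nat
    by (intro tendsto_intros ratio small) (use \<delta> in simp)
  have "(\<lambda>n. G (n + k + j * c n) / real ((2 * (n + k + j * c n) + 1)\<^sup>2) *
      ((2 * real j * (real (c n) / real n) + 2 + (2 * real k + 1) / real n)\<^sup>2 / (real (c n) / real n)))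
      \<longlonglongrightarrow> h * ((2 * real j * \<delta> + 2 + 0)\<^sup>2 / \<delta>)" for j
    by (intro tendsto_mult scale G') simp
  then have part: "(\<lambda>n. G (n + k + j * c n) / real (c n) / real n)
      \<longlonglongrightarrow> h * ((2 * real j * \<delta> + 2 + 0)\<^sup>2 / \<delta>)" for j
  proof (rule Lim_transform_eventually)
    show "eventually (\<lambda>n. G (n + k + j * c n) / real ((2 * (n + k + j * c n) + 1)\<^sup>2) *
      ((2 * real j * (real (c n) / real n) + 2 + (2 * real k + 1) / real n)\<^sup>2 / (real (c n) / real n))
      = G (n + k + j * c n) / real (c n) / real n) sequentially"
      using eventually_gt_at_top[of 0]
    proof eventually_elim
      case (elim n)
      have sq: "2 * real j * (real (c n) / real n) + 2 + (2 * real k + 1) / real n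
          = real (2 * (n + k + j * c n) + 1) / real n"
        using elim by (simp add: field_simps)
      have cancel: "x / real (y\<^sup>2) * ((real y / real n)\<^sup>2 / (real (c n) / real n)) = x / real (c n) / real n"
        if "y > 0" for x y
        using elim that by (simp add: power2_eq_square field_simps)
      show ?case
        unfolding sq by (rule cancel) simp
    qed
  qed
  have "(\<lambda>n. G (n + k + r * c n) / real (c n) / real n - G (n + k + 0 * c n) / real (c n) / real n)
      \<longlonglongrightarrow> h * ((2 * real r * \<delta> + 2 + 0)\<^sup>2 / \<delta>) - h * ((2 * real 0 * \<delta> + 2 + 0)\<^sup>2 / \<delta>)"
    by (intro tendsto_diff part)
  moreover have "h * ((2 * real r * \<delta> + 2 + 0)\<^sup>2 / \<delta>) - h * ((2 * real 0 * \<delta> + 2 + 0)\<^sup>2 / \<delta>)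
      = (8 * real r + 4 * (real r)\<^sup>2 * \<delta>) * h"
    using \<delta> by (simp add: power2_eq_square field_simps)
  ultimately show ?thesis
    by (simp add: diff_divide_distrib)
qed

context shift_invariant_measure
begin

text \<open>\<open>E N\<close> is covered by translates of \<open>E n\<close> along the lattice of mesh \<open>2 n + 1\<close>, at most
  \<open>2 N / (2 n + 1) + 2\<close> of them in each direction.\<close>

lemma H_pattern_cover:
  "H (pattern (E N)) \<le> (2 * real N / real (2 * n + 1) + 2)\<^sup>2 * H (pattern (E n))"
proof -
  define d where "d = 2 * int n + 1"
  \<comment> \<open>The possible quotients \<open>(a + int n) div d\<close> for \<open>a\<close>
    between \<open>- int N\<close> and \<open>int N\<close>.\<close>
  define I where "I = {(int n - int N) div d..(int n + int N) div d}"
  let ?X = "\<lambda>(i, j). pattern (E n) \<circ> shift (d * i, d * j)"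
  have d: "d > 0"
    by (simp add: d_def)
  have sfX: "simple_function M (?X q)" for q
    by (cases q) (auto intro!: simple_function_comp_invariant shift_invariant simple_function_pattern)
  have HX: "H (?X q) = H (pattern (E n))" for q
    by (cases q) (simp add: H_invariant shift_invariant simple_function_pattern)
  have "H (pattern (E N)) \<le> H (joint (I \<times> I) ?X)"
  proof (rule H_mono)
    fix x y assume eq: "joint (I \<times> I) ?X x = joint (I \<times> I) ?X y"
    have "x (a, b) = y (a, b)" if "(a, b) \<in> E N" for a b
    proof -
      \<comment> \<open>Rounds to the nearest lattice point: the offset \<open>a - d * i\<close>
        equals \<open>(a + int n) mod d - int n\<close>, hence lies between \<open>- int n\<close>
        and \<open>int n\<close>.\<close>
      define i j where "i = (a + int n) div d" and "j = (b + int n) div d"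
      have "i \<in> I" "j \<in> I"
        using that d by (auto simp: i_def j_def I_def E_def intro!: zdiv_mono1)
      moreover have "(a - d * i, b - d * j) \<in> E n"
        using pos_mod_bound[OF d, of "a + int n"] pos_mod_sign[OF d, of "a + int n"]
          pos_mod_bound[OF d, of "b + int n"] pos_mod_sign[OF d, of "b + int n"]
        by (auto simp: E_def i_def j_def minus_mult_div_eq_mod[symmetric] d_def)
      ultimately have "shift (d * i, d * j) x (a - d * i, b - d * j) = shift (d * i, d * j) y (a - d * i, b - d * j)"
        using eq by (auto simp: joint_eq_iff pattern_eq_iff)
      then show ?thesis
        by (simp add: shift_def)
    qed
    then show "pattern (E N) x = pattern (E N) y"
      by (auto simp: pattern_eq_iff)
  qed (intro simple_function_joint sfX; simp add: I_def)
  also have "\<dots> \<le> (\<Sum>q\<in>I \<times> I. H (?X q))"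
    by (rule H_joint_le_sum) (use sfX in \<open>auto simp: I_def\<close>)
  also have "\<dots> = (real (card I))\<^sup>2 * H (pattern (E n))"
    by (simp add: HX card_cartesian_product power2_eq_square)
  also have "\<dots> \<le> (2 * real N / real (2 * n + 1) + 2)\<^sup>2 * H (pattern (E n))"
  proof (intro mult_right_mono power_mono H_nonneg simple_function_pattern finite_E)
    have floor: "a div b = \<lfloor>real_of_int a / real_of_int b\<rfloor>" for a b
      by (simp add: floor_divide_of_int_eq)
    have le: "(int n - int N) div d \<le> (int n + int N) div d"
      using d by (intro zdiv_mono1) auto
    then have "real (card I) = real_of_int ((int n + int N) div d) - real_of_int ((int n - int N) div d) + 1"
      by (simp add: I_def)
    \<comment> \<open>Rounding down the lower end loses at most 1 and counting both ends adds 1,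
      whence the summand \<open>2\<close>.\<close>
    also have "\<dots> \<le> real_of_int (int n + int N) / real_of_int d
        - (real_of_int (int n - int N) / real_of_int d - 1) + 1"
      unfolding floor by linarith
    also have "\<dots> = 2 * real N / real (2 * n + 1) + 2"
      by (simp add: d_def diff_divide_distrib add_divide_distrib add.commute)
    finally show "real (card I) \<le> 2 * real N / real (2 * n + 1) + 2" .
  qed simp
  finally show ?thesis .
qed

lemma shift_entropy_tendsto:
  "(\<lambda>n. H (pattern (E n)) / real ((2 * n + 1)\<^sup>2)) \<longlonglongrightarrow> shift_entropy M"
proof -
  \<comment> \<open>The join reads the coordinates \<open>- v\<close>; the square \<open>E n\<close>
    is symmetric.\<close>
  have "fibers (joint (E n) (\<lambda>v. (\<lambda>x. x (0, 0)) \<circ> shift (- v))) = fibers (pattern (E n) :: 'a config \<Rightarrow> _)" for n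
  proof (rule fibers_cong)
    fix x y :: "'a config"
    have "shift (- v) x (0, 0) = x (- v)" for v and x :: "'a config"
      by (simp add: shift_def flip: zero_prod_def)
    then show "joint (E n) (\<lambda>v. (\<lambda>x. x (0, 0)) \<circ> shift (- v)) x = joint (E n) (\<lambda>v. (\<lambda>x. x (0, 0)) \<circ> shift (- v)) y
        \<longleftrightarrow> pattern (E n) x = pattern (E n) y"
      unfolding joint_eq_iff pattern_eq_iff comp_def by (metis minus_minus uminus_in_E_iff)
  qed
  then have "shift_entropy M = lim (\<lambda>n. H (pattern (E n)) / real ((2 * n + 1)\<^sup>2))"
    by (simp add: shift_entropy_def S0_eq_fibers shift_join_fibers)
  moreover have "convergent (\<lambda>n. H (pattern (E n)) / real ((2 * n + 1)\<^sup>2))"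
  proof (rule convergent_eventually_le_member)
    show "0 \<le> H (pattern (E n)) / real ((2 * n + 1)\<^sup>2)" for n
      by (intro divide_nonneg_nonneg H_nonneg simple_function_pattern) auto
    fix n :: nat and e :: real
    assume "e > 0"
    define d where "d = real (2 * n + 1)"
    have "d > 0"
      by (simp add: d_def)
    \<comment> \<open>The number of covering squares per unit area tends to the inverse area of one
      square, so the value at \<open>n\<close> bounds later values up to \<open>e\<close>.\<close>
    then have "(\<lambda>N. (2 * real N / d + 2)\<^sup>2 / (2 * real N + 1)\<^sup>2) \<longlonglongrightarrow> (inverse d)\<^sup>2"
      by real_asymp
    from tendsto_mult_right[OF this, of "H (pattern (E n))"]
    have "(\<lambda>N. (2 * real N / d + 2)\<^sup>2 * H (pattern (E n)) / (2 * real N + 1)\<^sup>2) \<longlonglongrightarrow> H (pattern (E n)) / d\<^sup>2"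
      by (simp add: inverse_eq_divide power_divide)
    then have "eventually (\<lambda>N. (2 * real N / d + 2)\<^sup>2 * H (pattern (E n)) / (2 * real N + 1)\<^sup>2
        < H (pattern (E n)) / d\<^sup>2 + e) sequentially"
      by (rule order_tendstoD) (use \<open>e > 0\<close> in simp)
    then show "eventually (\<lambda>N. H (pattern (E N)) / real ((2 * N + 1)\<^sup>2)
        \<le> H (pattern (E n)) / real ((2 * n + 1)\<^sup>2) + e) sequentially"
    proof eventually_elim
      case (elim N)
      have "H (pattern (E N)) / (2 * real N + 1)\<^sup>2
          \<le> (2 * real N / d + 2)\<^sup>2 * H (pattern (E n)) / (2 * real N + 1)\<^sup>2"
        unfolding d_def by (intro divide_right_mono H_pattern_cover) simp
      with elim show ?case
        by (simp add: d_def add.commute)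
    qed
  qed
  ultimately show ?thesis
    by (simp add: convergent_LIMSEQ_iff)
qed

lemma dyn_entropy_pattern_le:
  assumes "has_radius F r" "invariant_under M F" "m \<ge> 1"
  shows "dyn_entropy M (fibers (pattern (E n))) F
    \<le> (H (pattern (E (n + r * m))) - H (pattern (E n))) / real m"
  by (rule dyn_entropy_le_increment)
     (use assms in \<open>auto intro!: simple_function_pattern intro: pattern_funpow_eq\<close>)

section \<open>Approximating a partition by cylinders in conditional entropy\<close>

lemma H_member_small:
  assumes "e > 0"
  obtains d where "d > 0" "\<And>A. A \<in> sets M \<Longrightarrow> prob A < d \<Longrightarrow> H (\<lambda>x. x \<in> A) < e"
proof -
  \<comment> \<open>The binary entropy function, which tends to 0 at 0.\<close>
  define \<eta> where "\<eta> p = - (p * ln p + (1 - p) * ln (1 - p))" for p :: real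
  have "(\<eta> \<longlongrightarrow> 0) (at_right 0)"
    unfolding \<eta>_def by real_asymp
  then have "eventually (\<lambda>p. \<eta> p < e) (at_right 0)"
    using \<open>e > 0\<close> by (rule order_tendstoD)
  then obtain d where d: "d > 0" "\<And>p. 0 < p \<Longrightarrow> p < d \<Longrightarrow> \<eta> p < e"
    by (auto simp: eventually_at_right_field)
  have "H (\<lambda>x. x \<in> A) < e" if A: "A \<in> sets M" "prob A < d" for A
  proof -
    have fib: "(\<lambda>x. x \<in> A) -` {b} = (if b then A else - A)" for b
      by auto
    have "(\<Sum>b\<in>range (\<lambda>x. x \<in> A). prob ((\<lambda>x. x \<in> A) -` {b}) * ln (prob ((\<lambda>x. x \<in> A) -` {b})))
        = (\<Sum>b\<in>UNIV. prob ((\<lambda>x. x \<in> A) -` {b}) * ln (prob ((\<lambda>x. x \<in> A) -` {b})))"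
    proof (rule sum.mono_neutral_left)
      show "\<forall>b\<in>UNIV - range (\<lambda>x. x \<in> A). prob ((\<lambda>x. x \<in> A) -` {b}) * ln (prob ((\<lambda>x. x \<in> A) -` {b})) = 0"
      proof
        fix b assume "b \<in> UNIV - range (\<lambda>x. x \<in> A)"
        then have "(\<lambda>x. x \<in> A) -` {b} = {}"
          by blast
        then show "prob ((\<lambda>x. x \<in> A) -` {b}) * ln (prob ((\<lambda>x. x \<in> A) -` {b})) = 0"
          by simp
      qed
    qed auto
    moreover have "prob (- A) = 1 - prob A"
      using prob_compl[OF A(1)] by (simp add: space_UNIV Compl_eq_Diff_UNIV)
    ultimately have "H (\<lambda>x. x \<in> A) = \<eta> (prob A)"
      unfolding H_eq_sum by (simp add: UNIV_bool fib \<eta>_def)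
    also have "\<dots> < e"
    \<comment> \<open>The right-hand limit says nothing about the point 0 itself; there
      \<open>\<eta>\<close> is 0.\<close>
    proof (cases "prob A = 0")
      case False
      then show ?thesis
        using A(2) by (intro d) (simp_all add: zero_less_measure_iff)
    qed (use \<open>e > 0\<close> in \<open>simp add: \<eta>_def\<close>)
    finally show ?thesis .
  qed
  with d(1) show thesis
    by (rule that)
qed

text \<open>Membership in \<open>A\<close> is determined by membership in \<open>C\<close> and in
  the symmetric difference.\<close>

lemma H_member_pair_le:
  assumes A: "A \<in> sets M" and C: "C \<in> sets M"
  shows "H (\<lambda>x. (x \<in> A, x \<in> C)) - H (\<lambda>x. x \<in> C) \<le> H (\<lambda>x. x \<in> (A - C) \<union> (C - A))"
proof -
  have sf: "simple_function M (\<lambda>x. x \<in> (A - C) \<union> (C - A))" "simple_function M (\<lambda>x. x \<in> C)"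
    by (rule simple_function_indicator_member; use assms in auto)+
  have "H (\<lambda>x. (x \<in> A, x \<in> C)) \<le> H (\<lambda>x. (x \<in> (A - C) \<union> (C - A), x \<in> C))"
    by (rule H_mono) (intro simple_function_Pair sf, blast)
  also have "\<dots> \<le> H (\<lambda>x. x \<in> (A - C) \<union> (C - A)) + H (\<lambda>x. x \<in> C)"
    by (intro H_subadditive sf)
  finally show ?thesis
    by simp
qed

text \<open>Each cell \<open>B\<close> is approximated separately by a determined set
  \<open>C B\<close>. These sets need not be disjoint, so the new partition is given by the vector
  of memberships in them.\<close>

lemma partition_approximation:
  assumes P: "finite P" "P \<subseteq> sets M" and e: "e > 0"
  obtains k and Y :: "'a config \<Rightarrow> 'a config set \<Rightarrow> bool" where
    "\<And>x y. pattern (E k) x = pattern (E k) y \<Longrightarrow> Y x = Y y"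
    "H (\<lambda>x. (joint P (\<lambda>B x. x \<in> B) x, Y x)) - H Y \<le> e"
proof -
  \<comment> \<open>An equal share of \<open>e\<close> for each cell; the \<open>1\<close> keeps the
    denominator positive.\<close>
  define e' where "e' = e / (real (card P) + 1)"
  have "e' > 0"
    using e by (simp add: e'_def)
  then obtain d where d: "d > 0" "\<And>A. A \<in> sets M \<Longrightarrow> prob A < d \<Longrightarrow> H (\<lambda>x. x \<in> A) < e'"
    using H_member_small by blast
  have "\<exists>k C. determined k C \<and> prob ((B - C) \<union> (C - B)) < d" if "B \<in> P" for B
    using approximable_sets[of B] P d(1) that unfolding approximable_def by blast
  then obtain k C where kC: "\<And>B. B \<in> P \<Longrightarrow> determined (k B) (C B) \<and> prob ((B - C B) \<union> (C B - B)) < d"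
    by metis
  define l where "l = (\<Sum>B\<in>P. k B)"
  have det: "determined l (C B)" if "B \<in> P" for B
    using determined_mono[of "k B" "C B" l] kC[OF that] P(1) that
    by (auto simp: l_def intro: member_le_sum)
  note C = determined_sets[OF det]
  let ?Y = "joint P (\<lambda>B x. x \<in> C B)"
  have "H (\<lambda>x. (joint P (\<lambda>B x. x \<in> B) x, ?Y x))
      \<le> H ?Y + (\<Sum>B\<in>P. H (\<lambda>x. (x \<in> B, x \<in> C B)) - H (\<lambda>x. x \<in> C B))"
    by (rule H_joint_le) (use P C in \<open>auto intro: simple_function_indicator_member\<close>)
  also have "(\<Sum>B\<in>P. H (\<lambda>x. (x \<in> B, x \<in> C B)) - H (\<lambda>x. x \<in> C B)) \<le> (\<Sum>B\<in>P. e')"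
  proof (rule sum_mono)
    fix B assume B: "B \<in> P"
    then have "(B - C B) \<union> (C B - B) \<in> sets M"
      using P C by (intro sets.Un sets.Diff) auto
    then have "H (\<lambda>x. x \<in> (B - C B) \<union> (C B - B)) < e'"
      using kC[OF B] by (intro d) auto
    moreover have "H (\<lambda>x. (x \<in> B, x \<in> C B)) - H (\<lambda>x. x \<in> C B) \<le> H (\<lambda>x. x \<in> (B - C B) \<union> (C B - B))"
      using P C B by (intro H_member_pair_le) auto
    ultimately show "H (\<lambda>x. (x \<in> B, x \<in> C B)) - H (\<lambda>x. x \<in> C B) \<le> e'"
      by linarith
  qed
  also have "(\<Sum>B\<in>P. e') \<le> e"
    using e by (simp add: e'_def field_simps)
  finally have "H (\<lambda>x. (joint P (\<lambda>B x. x \<in> B) x, ?Y x)) - H ?Y \<le> e"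
    by simp
  moreover have "?Y x = ?Y y" if "pattern (E l) x = pattern (E l) y" for x y
    using det that that[symmetric] unfolding joint_eq_iff determined_def by blast
  ultimately show thesis
    using that by blast
qed

section \<open>The bound for a single partition\<close>

lemma dyn_entropy_shift_join_le:
  assumes F: "has_radius F r" "invariant_under M F"
    and Y: "\<And>x y. pattern (E k) x = pattern (E k) y \<Longrightarrow> Y x = Y y"
    and X: "simple_function M X" and V: "V \<subseteq> E n" and m: "m \<ge> 1"
  shows "dyn_entropy M (shift_join V (fibers X)) F
    \<le> (H (pattern (E (n + k + r * m))) - H (pattern (E (n + k)))) / real m
      + real (card V) * (H (\<lambda>x. (X x, Y x)) - H Y)"
proof -
  have finV: "finite V"
    using V by (rule finite_subset) simp
  have sfY: "simple_function M Y"
    by (rule simple_function_factor[OF simple_function_pattern Y]) simp_all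
  have sf: "simple_function M (X \<circ> shift v)" "simple_function M (Y \<circ> shift v)" for v
    by (intro simple_function_comp_invariant shift_invariant X sfY)+
  \<comment> \<open>Trading \<open>X\<close> for \<open>Y\<close> at every site of \<open>V\<close>;
    by shift invariance each site costs the same conditional entropy.\<close>
  have "dyn_entropy M (shift_join V (fibers X)) F
      \<le> dyn_entropy M (fibers (joint V (\<lambda>v. Y \<circ> shift (- v)))) F
        + (\<Sum>v\<in>V. H (\<lambda>x. ((X \<circ> shift (- v)) x, (Y \<circ> shift (- v)) x)) - H (Y \<circ> shift (- v)))"
    unfolding shift_join_fibers by (intro dyn_entropy_joint_le F finV sf)
  also have "(\<Sum>v\<in>V. H (\<lambda>x. ((X \<circ> shift (- v)) x, (Y \<circ> shift (- v)) x)) - H (Y \<circ> shift (- v)))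
      = (\<Sum>v\<in>V. H (\<lambda>x. (X x, Y x)) - H Y)"
  proof (rule sum.cong)
    fix v
    show "H (\<lambda>x. ((X \<circ> shift (- v)) x, (Y \<circ> shift (- v)) x)) - H (Y \<circ> shift (- v))
        = H (\<lambda>x. (X x, Y x)) - H Y"
      using H_invariant[OF shift_invariant simple_function_Pair[OF X sfY], of "- v"]
        H_invariant[OF shift_invariant sfY, of "- v"]
      by (simp add: comp_def)
  qed simp
  \<comment> \<open>A translate of \<open>Y\<close> by a vector of \<open>E n\<close> reads only
    coordinates within \<open>E (n + k)\<close>.\<close>
  also have "dyn_entropy M (fibers (joint V (\<lambda>v. Y \<circ> shift (- v)))) F \<le> dyn_entropy M (fibers (pattern (E (n + k)))) F"
  proof (rule dyn_entropy_mono)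
    fix x y :: "'a config"
    assume eq: "pattern (E (n + k)) x = pattern (E (n + k)) y"
    have "Y (shift (- v) x) = Y (shift (- v) y)" if "v \<in> V" for v
    proof (rule Y, unfold pattern_eq_iff, rule ballI)
      fix u assume "u \<in> E k"
      moreover have "- v \<in> E n"
        using V that by auto
      ultimately have "u + - v \<in> E (n + k)"
        using E_add[of u k "- v" n] by (simp add: add.commute)
      then show "shift (- v) x u = shift (- v) y u"
        using eq unfolding shift_def pattern_eq_iff by blast
    qed
    then show "joint V (\<lambda>v. Y \<circ> shift (- v)) x = joint V (\<lambda>v. Y \<circ> shift (- v)) y"
      by (auto simp: joint_eq_iff)
  qed (intro F simple_function_pattern finite_E)+
  also have "\<dots> \<le> (H (pattern (E (n + k + r * m))) - H (pattern (E (n + k)))) / real m"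
    by (intro dyn_entropy_pattern_le F m)
  finally show ?thesis
    by simp
qed

lemma ER_partition_le:
  assumes F: "has_radius F r" "invariant_under M F" and P: "finite_measurable_partition P" and \<epsilon>: "\<epsilon> > 0"
  shows "ER_partition r M P F
    \<le> ereal ((8 * real r + 4 * (real r)\<^sup>2 * \<epsilon>) * shift_entropy M + 8 * real r * \<epsilon>)"
proof -
  let ?X = "joint P (\<lambda>B x. x \<in> B)"
  have P': "finite P" "P \<subseteq> sets M" "partition_on UNIV P"
    using P by (auto simp: finite_measurable_partition_def sets_M)
  have X: "simple_function M ?X"
    using P' by (intro simple_function_joint simple_function_indicator_member) auto
  obtain k and Y :: "'a config \<Rightarrow> 'a config set \<Rightarrow> bool"
    where Y: "\<And>x y. pattern (E k) x = pattern (E k) y \<Longrightarrow> Y x = Y y"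
      "H (\<lambda>x. (?X x, Y x)) - H Y \<le> \<epsilon>"
    using partition_approximation[OF P'(1,2) \<epsilon>] by blast
  \<comment> \<open>The block length. The same \<open>\<epsilon>\<close> sets the time scale and the
    approximation error, so one limit removes both.\<close>
  define c where "c n = nat \<lceil>\<epsilon> * real n\<rceil>" for n
  define b where "b n = (H (pattern (E (n + k + r * c n))) - H (pattern (E (n + k)))) / real (c n) / real n
      + (8 * real r + 4 * real r / real n) * \<epsilon>" for n
  \<comment> \<open>\<open>n \<ge> r\<close> serves the count of the ring, \<open>n \<ge> 1\<close>
    makes the block length positive.\<close>
  have "dyn_entropy M (shift_join (E_ring r n) P) F / real n \<le> b n" if n: "n \<ge> max r 1" for n
  proof -
    have "c n \<ge> 1"
      using n \<epsilon> by (simp add: c_def Suc_le_eq)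
    then have "dyn_entropy M (shift_join (E_ring r n) P) F
        \<le> (H (pattern (E (n + k + r * c n))) - H (pattern (E (n + k)))) / real (c n)
          + real (card (E_ring r n)) * (H (\<lambda>x. (?X x, Y x)) - H Y)"
      by (subst partition_eq_fibers[OF P'(3)])
         (intro dyn_entropy_shift_join_le F Y X; auto simp: E_ring_def)
    also have "real (card (E_ring r n)) * (H (\<lambda>x. (?X x, Y x)) - H Y) \<le> real (card (E_ring r n)) * \<epsilon>"
      by (intro mult_left_mono Y) simp
    also have "\<dots> \<le> (8 * real r * real n + 4 * real r) * \<epsilon>"
      using n \<epsilon> by (intro mult_right_mono card_E_ring_le) auto
    finally have "dyn_entropy M (shift_join (E_ring r n) P) F / real n
        \<le> ((H (pattern (E (n + k + r * c n))) - H (pattern (E (n + k)))) / real (c n)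
          + (8 * real r * real n + 4 * real r) * \<epsilon>) / real n"
      by (intro divide_right_mono) auto
    also have "\<dots> = b n"
      using n by (simp add: b_def add_divide_distrib distrib_right)
    finally show ?thesis .
  qed
  then have "eventually (\<lambda>n. ereal (dyn_entropy M (shift_join (E_ring r n) P) F / real n) \<le> ereal (b n)) sequentially"
    by (intro eventually_sequentiallyI[of "max r 1"]) simp
  then have "ER_partition r M P F \<le> limsup (\<lambda>n. ereal (b n))"
    unfolding ER_partition_def by (rule Limsup_mono)
  also have "b \<longlonglongrightarrow> (8 * real r + 4 * (real r)\<^sup>2 * \<epsilon>) * shift_entropy M + (8 * real r + 0) * \<epsilon>"
    unfolding b_def c_def
    by (intro tendsto_add tendsto_mult tendsto_const tendsto_square_increment shift_entropy_tendsto \<epsilon>) real_asymp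
  then have "limsup (\<lambda>n. ereal (b n))
      = ereal ((8 * real r + 4 * (real r)\<^sup>2 * \<epsilon>) * shift_entropy M + 8 * real r * \<epsilon>)"
    by (intro lim_imp_Limsup) (auto simp: mult_ac)
  finally show ?thesis .
qed

end

theorem theorem1:
  fixes F :: "('a::finite) config \<Rightarrow> 'a config"
    and \<mu> :: "'a config measure"
    and r :: nat
  assumes "cellular_automaton F"
    and "has_radius F r"
    and "prob_space \<mu>"
    and "sets \<mu> = sets config_borel"
    and "bi_invariant \<mu> F"
  shows "ER r \<mu> F \<le> ereal (8 * real r * shift_entropy \<mu>)"
proof -
  interpret shift_invariant_measure \<mu>
    using assms by (intro shift_invariant_measure.intro shift_invariant_measure_axioms.intro)
      (auto simp: bi_invariant_def)
  have F: "invariant_under \<mu> F"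
    using assms(5) by (simp add: bi_invariant_def)
  show ?thesis
    unfolding ER_def
  proof (rule SUP_least, unfold mem_Collect_eq)
    fix P :: "'a config set set" assume P: "finite_measurable_partition P"
    let ?u = "\<lambda>\<epsilon>. (8 * real r + 4 * (real r)\<^sup>2 * \<epsilon>) * shift_entropy \<mu> + 8 * real r * \<epsilon>"
    \<comment> \<open>The left side of the bound does not involve \<open>\<epsilon>\<close>, so
      letting it tend to 0 from the right leaves only the entropy term.\<close>
    have "(?u \<longlongrightarrow> ?u 0) (at_right 0)"
      by (intro tendsto_intros)
    then have "((\<lambda>\<epsilon>. ereal (?u \<epsilon>)) \<longlongrightarrow> ereal (8 * real r * shift_entropy \<mu>)) (at_right 0)"
      by simp
    moreover have "eventually (\<lambda>\<epsilon>. ER_partition r \<mu> P F \<le> ereal (?u \<epsilon>)) (at_right 0)"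
      using eventually_at_right_less[of 0]
      by eventually_elim (rule ER_partition_le[OF assms(2) F P])
    ultimately show "ER_partition r \<mu> P F \<le> ereal (8 * real r * shift_entropy \<mu>)"
      by (rule tendsto_lowerbound) simp
  qed
qed

end
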